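(* Let $G$ be a connected planar finite quadrangulation with a boundary, with vertex set $V$ and set of internal faces $F$, with a fixed bipartite colouring of $V$ into black and white vertices, and such that no train track of $G$ is a loop. Suppose that every face $f\in F$ carries positive weights $w^f_1,\dots,w^f_5$ satisfying $$w^f_1 w^f_4 = w^f_3 w^f_5,\qquad w^f_2 w^f_3 = w^f_4 w^f_5,\qquad w^f_5(w^f_1+w^f_2)=w^f_3w^f_4 .$$ Then there exist positive real numbers $(g_v)_{v\in V}$ and positive constants $(c_f)_{f\in F}$ such that for every $f\in F$, with black vertices $x,y$ and white vertices $u,v$, $$c_fw^f_1=g_xg_y,\quad c_fw^f_2=g_ug_v,\quad c_fw^f_3=\sqrt{g_xg_y}\sqrt{g_xg_y+g_ug_v},\quad c_fw^f_4=\sqrt{g_ug_v}\sqrt{g_xg_y+g_ug_v},\quad c_fw^f_5=\sqrt{g_xg_yg_ug_v}.$$ In particular, this holds whenever $G$ is a lozenge graph.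
   Context: A quadrangulation with a boundary is a finite simple graph $G=(V,E)$ properly embedded in the plane such that all internal (bounded) faces have degree $4$. A train track of $G$ is a path on the dual graph $G^*$ (where boundary edges of $G$ have dual half-edges that are not connected at the external face) such that whenever it enters a face it exits through the opposite edge of that face; it is a loop if it closes up. A lozenge graph is a finite planar quadrangulation whose internal faces are all non-degenerate rhombi with the same edge length. *)

theory Defs
  imports "HOL-Analysis.Analysis"
begin

text \<open>
  A simple graph (edges are two-element vertex sets) together with a drawing in the plane
  \<^typ>\<open>complex\<close>: \<open>vpos\<close> places the vertices, and \<open>curve\<close> assigns to each edge an arc whose
  orientation is irrelevant.
\<close>

record 'v drawn_graph =
  verts :: "'v set"
  edges :: "'v set set"
  vpos  :: "'v \<Rightarrow> complex"
  curve :: "'v set \<Rightarrow> real \<Rightarrow> complex"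

definition plane_graph :: "'v drawn_graph \<Rightarrow> bool" where
  "plane_graph G \<longleftrightarrow>
     finite (verts G) \<and>
     (\<forall>e\<in>edges G. e \<subseteq> verts G \<and> card e = 2) \<and>
     inj_on (vpos G) (verts G) \<and>
     (\<forall>e\<in>edges G. arc (curve G e) \<and>
        {pathstart (curve G e), pathfinish (curve G e)} = vpos G ` e \<and>
        path_image (curve G e) \<inter> vpos G ` verts G = vpos G ` e) \<and>
     (\<forall>e\<in>edges G. \<forall>e'\<in>edges G. e \<noteq> e' \<longrightarrow>
        path_image (curve G e) \<inter> path_image (curve G e') = vpos G ` (e \<inter> e'))"

definition graph_connected :: "'v drawn_graph \<Rightarrow> bool" where
  "graph_connected G \<longleftrightarrow>
     (\<forall>a\<in>verts G. \<forall>b\<in>verts G. (a, b) \<in> {(p, q). {p, q} \<in> edges G}\<^sup>*)"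

definition drawing :: "'v drawn_graph \<Rightarrow> complex set" where
  "drawing G = vpos G ` verts G \<union> (\<Union>e\<in>edges G. path_image (curve G e))"

definition faces :: "'v drawn_graph \<Rightarrow> complex set set" where
  "faces G = components (- drawing G)"

definition internal_faces :: "'v drawn_graph \<Rightarrow> complex set set" where
  "internal_faces G = {f \<in> faces G. bounded f}"

definition face_edges :: "'v drawn_graph \<Rightarrow> complex set \<Rightarrow> 'v set set" where
  "face_edges G f = {e \<in> edges G. path_image (curve G e) \<subseteq> frontier f}"

definition face_verts :: "'v drawn_graph \<Rightarrow> complex set \<Rightarrow> 'v set" where
  "face_verts G f = {v \<in> verts G. vpos G v \<in> frontier f}"

text \<open>
  The degree is the length of the boundary walk: an edge that has \<open>f\<close> on both of its sides,
  i.e. that borders no other face, is traversed twice.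
\<close>

definition face_degree :: "'v drawn_graph \<Rightarrow> complex set \<Rightarrow> nat" where
  "face_degree G f =
     (\<Sum>e\<in>face_edges G f. if \<exists>f'\<in>faces G. f' \<noteq> f \<and> e \<in> face_edges G f' then 1 else 2)"

definition quadrangulation :: "'v drawn_graph \<Rightarrow> bool" where
  "quadrangulation G \<longleftrightarrow> plane_graph G \<and> (\<forall>f\<in>internal_faces G. face_degree G f = 4)"

text \<open>The colouring is given by the set \<open>B\<close> of black vertices; the others are white.\<close>

definition bipartite_colouring :: "'v drawn_graph \<Rightarrow> 'v set \<Rightarrow> bool" where
  "bipartite_colouring G B \<longleftrightarrow>
     B \<subseteq> verts G \<and> (\<forall>e\<in>edges G. \<exists>b\<in>B. \<exists>v\<in>verts G - B. e = {b, v})"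

text \<open>Two edges of a face of degree 4 are opposite iff they have no common endpoint.\<close>

definition opposite_edges :: "'v drawn_graph \<Rightarrow> complex set \<Rightarrow> 'v set \<Rightarrow> 'v set \<Rightarrow> bool" where
  "opposite_edges G f e e' \<longleftrightarrow> e \<in> face_edges G f \<and> e' \<in> face_edges G f \<and> e \<inter> e' = {}"

text \<open>
  A train track is recorded as the alternating sequence
  \<open>es ! 0, fs ! 0, es ! 1, fs ! 1, \<dots>\<close> of the edges it crosses and the internal faces it visits.
  Since it crosses \<open>es ! Suc i\<close>, the faces before and after that edge differ; the external face
  is never visited. A loop is such a sequence that closes up at its first edge, which is
  crossed from the last face into the first one.
\<close>

definition train_track :: "'v drawn_graph \<Rightarrow> 'v set list \<Rightarrow> complex set list \<Rightarrow> bool" where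
  "train_track G es fs \<longleftrightarrow>
     set es \<subseteq> edges G \<and> set fs \<subseteq> internal_faces G \<and> length es = Suc (length fs) \<and>
     (\<forall>i<length fs. opposite_edges G (fs ! i) (es ! i) (es ! Suc i)) \<and>
     (\<forall>i. Suc i < length fs \<longrightarrow> fs ! i \<noteq> fs ! Suc i)"

definition is_loop :: "'v set list \<Rightarrow> complex set list \<Rightarrow> bool" where
  "is_loop es fs \<longleftrightarrow> fs \<noteq> [] \<and> hd es = last es \<and> hd fs \<noteq> last fs"

text \<open>A rhombus is a quadrilateral with four straight sides of the same length.\<close>

definition rhombic_face :: "'v drawn_graph \<Rightarrow> real \<Rightarrow> complex set \<Rightarrow> bool" where
  "rhombic_face G l f \<longleftrightarrow>
     (\<exists>x u y v. distinct [x, u, y, v] \<and> face_verts G f = {x, u, y, v} \<and>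
        face_edges G f = {{x, u}, {u, y}, {y, v}, {v, x}} \<and>
        path_image (curve G {x, u}) = closed_segment (vpos G x) (vpos G u) \<and>
        path_image (curve G {u, y}) = closed_segment (vpos G u) (vpos G y) \<and>
        path_image (curve G {y, v}) = closed_segment (vpos G y) (vpos G v) \<and>
        path_image (curve G {v, x}) = closed_segment (vpos G v) (vpos G x) \<and>
        dist (vpos G x) (vpos G u) = l \<and> dist (vpos G u) (vpos G y) = l \<and>
        dist (vpos G y) (vpos G v) = l \<and> dist (vpos G v) (vpos G x) = l \<and>
        \<not> collinear (vpos G ` {x, u, y, v}))"

definition lozenge_graph :: "'v drawn_graph \<Rightarrow> bool" where
  "lozenge_graph G \<longleftrightarrow>
     quadrangulation G \<and> (\<exists>l>0. \<forall>f\<in>internal_faces G. rhombic_face G l f)"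

text \<open>
  The displayed formulas are symmetric under exchanging \<open>x, y\<close> and under exchanging \<open>u, v\<close>, so
  the existential quantifier over the labelling of the corners agrees with the universal one.
\<close>

definition vertex_parametrised ::
    "'v drawn_graph \<Rightarrow> 'v set \<Rightarrow> (complex set \<Rightarrow> nat \<Rightarrow> real) \<Rightarrow> bool" where
  "vertex_parametrised G B w \<longleftrightarrow>
     (\<exists>(g :: 'v \<Rightarrow> real) (c :: complex set \<Rightarrow> real).
        (\<forall>v\<in>verts G. g v > 0) \<and> (\<forall>f\<in>internal_faces G. c f > 0) \<and>
        (\<forall>f\<in>internal_faces G. \<exists>x y u v. x \<noteq> y \<and> u \<noteq> v \<and>
           face_verts G f \<inter> B = {x, y} \<and> face_verts G f - B = {u, v} \<and>
           c f * w f 1 = g x * g y \<and>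
           c f * w f 2 = g u * g v \<and>
           c f * w f 3 = sqrt (g x * g y) * sqrt (g x * g y + g u * g v) \<and>
           c f * w f 4 = sqrt (g u * g v) * sqrt (g x * g y + g u * g v) \<and>
           c f * w f 5 = sqrt (g x * g y * g u * g v)))"

end

theory Submission
  imports Defs
begin

text \<open>
  Taking square roots, the three relations between the weights of a face say that, up to the scaling
  \<open>c\<^sub>f\<close>, the weights depend only on the ratio \<open>w\<^sub>1 / w\<^sub>2\<close> (\<open>weights_from_potential\<close>). So the task is to find
  \<open>h = ln g\<close> on the vertices with \<open>h x + h y - h u - h v = a\<^sub>f\<close> on every face, where \<open>a\<^sub>f = ln (w\<^sub>1 / w\<^sub>2)\<close>.

  In terms of the differences \<open>k {b, w} = h b - h w\<close> along the edges, this equation reads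
  \<open>k e + k e' = a\<^sub>f\<close>, for either of the two pairs \<open>e, e'\<close> of opposite edges of \<open>f\<close>. Solving it for \<open>k\<close> instead of \<open>h\<close>
  is propagation along the train tracks, and possible since no track closes up
  (\<open>acyclic_links_solvable\<close>). Subtracting the equations for the two pairs of opposite edges shows that \<open>k\<close>
  is closed around each internal face, and in the plane a closed form is exact: it comes from some \<open>h\<close>
  (\<open>closed_form_exact\<close>). The latter is proved by peeling faces off from outside.

  What makes this work for edges that are arbitrary arcs are three topological facts, all derived from
  Janiszewski's theorem and the Jordan curve theorem: a face that touches the inside of an edge has the
  whole edge on its boundary (\<open>arc_frontier\<close>), forests do not separate the plane
  (\<open>connected_Compl_forest\<close>), and cycles do (\<open>bridge_if_no_bounded_component\<close>). The second one also shows
  that internal faces of degree 4 are bounded by 4-cycles (\<open>face_four_cycle\<close>).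

  In a lozenge graph all edges crossed by a train track are parallel, and the track moves strictly
  monotonically in the orthogonal direction, so it is never a loop (\<open>lozenge_no_loop\<close>).
\<close>

section \<open>Arcs on the boundary of a complementary component\<close>

lemma interior_arc_empty:
  fixes \<gamma> :: "real \<Rightarrow> complex"
  assumes "arc \<gamma>"
  shows "interior (path_image \<gamma>) = {}"
proof (rule ccontr)
  assume ne: "interior (path_image \<gamma>) \<noteq> {}"
  have "path_image \<gamma> homeomorphic {0..1::real}"
    by (simp add: assms homeomorphic_arc_image_interval)
  then obtain f g where h: "homeomorphism (path_image \<gamma>) {0..1::real} f g"
    unfolding homeomorphic_def by blast
  have "continuous_on (interior (path_image \<gamma>)) f" "inj_on f (interior (path_image \<gamma>))"
    using h interior_subset unfolding homeomorphism_def
    by (meson continuous_on_subset, metis inj_on_inverseI subsetD)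
  then have "DIM(complex) \<le> DIM(real)"
    using invariance_of_dimension ne open_interior by blast
  then show False by simp
qed

text \<open>
  Any two points off \<open>R \<union> M\<close> that are joined off \<open>R\<close> are also joined off \<open>R \<union> M\<close>, by Janiszewski's
  theorem, because \<open>M\<close> does not separate the plane and meets \<open>R\<close> in a connected set. Hence \<open>f\<close> lies on
  both sides of \<open>M\<close> near \<open>p\<close> and fills a neighbourhood of \<open>p\<close> up to \<open>M\<close> itself.
\<close>

lemma frontier_pendant_set:
  fixes M R :: "complex set"
  assumes M: "compact M" "connected (- M)" "interior M = {}"
    and R: "closed R" and MR: "connected (M \<inter> R)"
    and f: "f \<in> components (- (R \<union> M))" and p: "p \<in> frontier f" "p \<in> M - R"
  obtains r where "r > 0" "ball p r \<inter> M \<subseteq> frontier f"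
proof -
  obtain r where r: "r > 0" "ball p r \<subseteq> - R"
    using p R by (metis ComplI DiffD2 open_Compl open_contains_ball_eq)
  have "p \<in> closure f" using p by (simp add: frontier_def)
  then obtain y where y: "y \<in> f" "dist y p < r"
    using r closure_approachable by blast
  have yc: "y \<in> - (R \<union> M)" using f y in_components_subset by blast
  have sub: "ball p r - M \<subseteq> f"
  proof
    fix z assume z: "z \<in> ball p r - M"
    have "connected_component (- M) y z"
      using M yc z unfolding connected_iff_connected_component by auto
    moreover have "connected_component (- R) y z"
      unfolding connected_component_def
      using r y z by (intro exI[of _ "ball p r"]) (auto simp: dist_commute)
    ultimately have "connected_component (- (M \<union> R)) y z"
      using Janiszewski[OF M(1) R MR] by blast
    then have "connected_component (- (R \<union> M)) y z" by (simp add: Un_commute)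
    moreover have "f = connected_component_set (- (R \<union> M)) y"
      using f y by (metis components_iff connected_component_eq)
    ultimately show "z \<in> f" by simp
  qed
  have "ball p r \<inter> M \<subseteq> frontier f"
  proof
    fix q assume q: "q \<in> ball p r \<inter> M"
    have "q \<in> closure (- M)" using M(3) closure_complement by auto
    then have "q \<in> closure (ball p r \<inter> - M)"
      using q open_Int_closure_subset[of "ball p r" "- M"] by blast
    then have "q \<in> closure f"
      by (metis Diff_eq closure_mono sub subsetD)
    moreover have "q \<notin> f" using f q in_components_subset by blast
    ultimately show "q \<in> frontier f"
      using interior_subset[of f] by (auto simp: frontier_def)
  qed
  with r that show ?thesis by blast
qed

text \<open>
  A larger component would be cut by \<open>frontier f\<close>, which still lies in the smaller set \<open>D'\<close>.
\<close>

lemma component_subset_Compl: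
  fixes f D D' :: "complex set"
  assumes "f \<in> components (- D)" "frontier f \<subseteq> D'" "D' \<subseteq> D"
  shows "f \<in> components (- D')"
proof -
  have ne: "f \<noteq> {}" "connected f" "f \<subseteq> - D'"
    using assms in_components_nonempty in_components_connected in_components_subset by blast+
  then obtain C where C: "C \<in> components (- D')" "f \<subseteq> C"
    using exists_component_superset by (metis Compl_empty_eq subset_empty)
  have "C = f"
  proof (rule ccontr)
    assume "C \<noteq> f"
    then have "C \<inter> frontier f \<noteq> {}"
      using C ne in_components_connected[OF C(1)] by (intro connected_Int_frontier) auto
    then show False using C(1) assms(2) in_components_subset by blast
  qed
  with C show ?thesis by simp
qed

text \<open>
  A face that touches the inside of an edge has the whole edge on its boundary. If some inner point
  \<open>q\<close> of the arc were not on the boundary, then a short piece of the arc around \<open>q\<close> could be erased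
  without changing the face. The two remaining pieces hang on \<open>R\<close> by at most one end, so that
  \<open>frontier f\<close> would be relatively open in the open arc; it is also relatively closed, and the open
  arc is connected.
\<close>

lemma arc_frontier:
  fixes \<gamma> :: "real \<Rightarrow> complex"
  assumes g: "arc \<gamma>" and R: "closed R"
    and gR: "path_image \<gamma> \<inter> R \<subseteq> {pathstart \<gamma>, pathfinish \<gamma>}"
    and f: "f \<in> components (- (R \<union> path_image \<gamma>))"
    and p: "p \<in> frontier f" "p \<in> path_image \<gamma> - {pathstart \<gamma>, pathfinish \<gamma>}"
  shows "path_image \<gamma> \<subseteq> frontier f"
proof -
  define I where "I = \<gamma> ` {0<..<1}"
  have Ieq: "I = path_image \<gamma> - {pathstart \<gamma>, pathfinish \<gamma>}"
    using g simple_path_endless arc_imp_simple_path unfolding I_def by metis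
  have cont: "continuous_on {0..1} \<gamma>" and inj: "inj_on \<gamma> {0..1}"
    using g unfolding arc_def path_def by auto
  have conI: "connected I" unfolding I_def
    by (rule connected_continuous_image) (auto intro: continuous_on_subset[OF cont])
  have opf: "open f"
    using f R g by (meson open_components open_Compl closed_Un closed_arc_image)
  have fdis: "f \<inter> (R \<union> path_image \<gamma>) = {}" using f in_components_subset by blast
  have frD: "frontier f \<subseteq> R \<union> path_image \<gamma>"
    using f R g frontier_of_components_closed_complement closed_Un closed_arc_image by metis
  have sub: "I \<subseteq> frontier f"
  proof (rule ccontr)
    assume "\<not> I \<subseteq> frontier f"
    then obtain q where q: "q \<in> I" "q \<notin> frontier f" by blast
    then obtain t where t: "0 < t" "t < 1" "q = \<gamma> t" unfolding I_def by auto
    have qc: "q \<notin> closure f" 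
      using q Ieq fdis opf by (auto simp: frontier_def interior_open)
    have "open (- closure f)" by auto
    then obtain r where r: "r > 0" "ball q r \<subseteq> - closure f"
      using qc by (metis ComplI open_contains_ball_eq)
    obtain d where d0: "d > 0" "\<And>s. s \<in> {0..1} \<Longrightarrow> dist s t < d \<Longrightarrow> dist (\<gamma> s) (\<gamma> t) < r"
      using cont t r(1) unfolding continuous_on_iff by (metis atLeastAtMost_iff less_imp_le)
    have d: "d > 0" "\<And>s. s \<in> {0..1} \<Longrightarrow> dist s t < d \<Longrightarrow> \<gamma> s \<in> - closure f"
      using d0 r t(3) by (auto simp: dist_commute subset_iff)
    define e where "e = Min {d/2, t/2, (1-t)/2}"
    have e: "0 < e" "e < d" "e < t" "e < 1 - t" using d t unfolding e_def by (auto simp: min_less_iff_disj)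
    have gap: "\<gamma> s \<notin> closure f" if "t - e \<le> s" "s \<le> t + e" for s
      using d(2)[of s] that e t by (auto simp: dist_real_def)
    define M1 where "M1 = \<gamma> ` {0..t-e}"
    define M2 where "M2 = \<gamma> ` {t+e..1}"
    have M1: "M1 = path_image (subpath 0 (t-e) \<gamma>)" "arc (subpath 0 (t-e) \<gamma>)"
      and M2: "M2 = path_image (subpath (t+e) 1 \<gamma>)" "arc (subpath (t+e) 1 \<gamma>)"
      using e t g by (auto simp: M1_def M2_def path_image_subpath intro!: arc_subpath_arc)
    have disj: "M1 \<inter> M2 = {}"
      using inj e t unfolding M1_def M2_def inj_on_def by force
    have M1R: "M1 \<inter> R \<subseteq> {\<gamma> 0}"
    proof
      fix z assume z: "z \<in> M1 \<inter> R"
      then obtain s where s: "z = \<gamma> s" "0 \<le> s" "s \<le> t - e" unfolding M1_def by auto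
      have "z \<noteq> \<gamma> 1" using inj_onD[OF inj, of s 1] s e t by auto
      then show "z \<in> {\<gamma> 0}" using z gR s e t by (force simp: path_image_def pathstart_def pathfinish_def)
    qed
    have M2R: "M2 \<inter> R \<subseteq> {\<gamma> 1}"
    proof
      fix z assume z: "z \<in> M2 \<inter> R"
      then obtain s where s: "z = \<gamma> s" "s \<le> 1" "t + e \<le> s" unfolding M2_def by auto
      have "z \<noteq> \<gamma> 0" using inj_onD[OF inj, of s 0] s e t by auto
      then show "z \<in> {\<gamma> 1}" using z gR s e t by (force simp: path_image_def pathstart_def pathfinish_def)
    qed
    have con: "connected (M1 \<inter> (R \<union> M2))" "connected (M2 \<inter> (R \<union> M1))"
      using M1R M2R disj by (metis Int_Un_distrib Un_empty_right connected_empty connected_sing subset_singletonD Int_commute)+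
    have "frontier f \<subseteq> R \<union> (M1 \<union> M2)"
    proof
      fix z assume z: "z \<in> frontier f"
      then have "z \<in> R \<or> (\<exists>s\<in>{0..1}. z = \<gamma> s)" using frD by (auto simp: path_image_def)
      then show "z \<in> R \<union> (M1 \<union> M2)"
        using gap z unfolding M1_def M2_def frontier_def
        by (metis Diff_iff UnCI atLeastAtMost_iff imageI linorder_le_cases)
    qed
    moreover have "M1 \<union> M2 \<subseteq> path_image \<gamma>"
      using e t by (auto simp: M1_def M2_def path_image_def)
    ultimately have fc: "f \<in> components (- (R \<union> (M1 \<union> M2)))"
      using component_subset_Compl[OF f] by blast
    have cl: "closed M1" "closed M2" "compact M1" "compact M2" "connected (- M1)" "connected (- M2)"
       "interior M1 = {}" "interior M2 = {}"
      using M1 M2 by (auto simp: closed_arc_image compact_arc_image connected_arc_complement interior_arc_empty)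
    define L where "L = \<gamma> ` {t-e..t+e}"
    have "compact L" unfolding L_def
      using e t by (intro compact_continuous_image continuous_on_subset[OF cont]) auto
    then have L: "closed L" "L \<inter> closure f = {}"
      using gap by (auto simp: L_def compact_imp_closed)
    have I3: "I \<subseteq> M1 \<union> L \<union> M2"
      unfolding I_def M1_def L_def M2_def image_Un[symmetric] by (rule image_mono) auto
    have key: "\<exists>r>0. ball z r \<inter> I \<subseteq> frontier f"
      if z: "z \<in> frontier f" "z \<in> M - (R \<union> N)" and MN: "M \<in> {M1, M2}" "N \<in> {M1, M2}" "M \<noteq> N" for z M N
    proof -
      have "(R \<union> N) \<union> M = R \<union> (M1 \<union> M2)" "connected (M \<inter> (R \<union> N))" "closed (R \<union> N)"
        using MN con R cl by auto
      then obtain r where r: "r > 0" "ball z r \<inter> M \<subseteq> frontier f"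
        using frontier_pendant_set[of M "R \<union> N" f z] fc z MN cl by auto
      have "z \<in> - (N \<union> L)" "open (- (N \<union> L))"
        using z L MN cl by (auto simp: frontier_def)
      then obtain r' where r': "r' > 0" "ball z r' \<subseteq> - (N \<union> L)"
        by (meson open_contains_ball_eq)
      have "ball z (min r r') \<inter> I \<subseteq> frontier f"
        using r r' I3 MN by fastforce
      then show ?thesis using r(1) r'(1) by (metis min_less_iff_conj)
    qed
    have nbhd: "\<exists>r>0. ball z r \<inter> I \<subseteq> frontier f" if z: "z \<in> I" "z \<in> frontier f" for z
    proof -
      have zR: "z \<notin> R" using z Ieq gR by blast
      have "z \<in> M1 \<union> M2" using z(2) zR \<open>frontier f \<subseteq> R \<union> (M1 \<union> M2)\<close> by blast
      moreover have "M1 \<noteq> M2" using disj M1(1) by auto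
      ultimately show ?thesis using key[of z M1 M2] key[of z M2 M1] z zR disj by blast
    qed
    have "openin (top_of_set I) (I \<inter> frontier f)"
      unfolding openin_contains_ball using nbhd by (auto simp: Int_commute)
    moreover have "closedin (top_of_set I) (I \<inter> frontier f)"
      by (simp add: closedin_closed_Int)
    ultimately show False
      using conI p q Ieq unfolding connected_clopen by blast
  qed
  have "path_image \<gamma> \<subseteq> closure I"
  proof -
    have "path_image \<gamma> = \<gamma> ` closure {0<..<1}" by (simp add: path_image_def)
    also have "\<dots> \<subseteq> closure I" unfolding I_def
      by (rule image_closure_subset) (auto simp: cont intro: subsetD[OF closure_subset])
    finally show ?thesis .
  qed
  also have "\<dots> \<subseteq> frontier f" using sub by (simp add: closure_minimal)
  finally show ?thesis .
qed

section \<open>Partial drawings of a plane graph\<close>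

text \<open>
  Edges and vertices of the drawing get erased independently of each other in what follows.
\<close>

definition sketch :: "'v drawn_graph \<Rightarrow> 'v set \<Rightarrow> 'v set set \<Rightarrow> complex set" where
  "sketch G W T = vpos G ` W \<union> (\<Union>e\<in>T. path_image (curve G e))"

definition adj :: "'v set set \<Rightarrow> ('v \<times> 'v) set" where
  "adj T = {(p, q). {p, q} \<in> T}"

lemma plane_graph_arc: "plane_graph G \<Longrightarrow> e \<in> edges G \<Longrightarrow> arc (curve G e)"
  by (simp add: plane_graph_def)

lemma plane_graph_ends:
  "plane_graph G \<Longrightarrow> e \<in> edges G \<Longrightarrow> {pathstart (curve G e), pathfinish (curve G e)} = vpos G ` e"
  by (simp add: plane_graph_def)

lemma plane_graph_edge:
  assumes "plane_graph G" "e \<in> edges G" shows "e \<subseteq> verts G" "card e = 2"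
  using assms by (simp_all add: plane_graph_def)

lemma plane_graph_inj: "plane_graph G \<Longrightarrow> inj_on (vpos G) (verts G)"
  by (simp add: plane_graph_def)

lemma plane_graph_finite: 
  assumes "plane_graph G" shows "finite (verts G)" "finite (edges G)"
proof -
  show "finite (verts G)" using assms by (simp add: plane_graph_def)
  then show "finite (edges G)" using assms unfolding plane_graph_def
    by (meson PowI finite_Pow_iff finite_subset subsetI)
qed

lemma arc_Int_verts:
  "plane_graph G \<Longrightarrow> e \<in> edges G \<Longrightarrow> path_image (curve G e) \<inter> vpos G ` verts G = vpos G ` e"
  by (simp add: plane_graph_def)

lemma arc_Int_arc:
  "plane_graph G \<Longrightarrow> e \<in> edges G \<Longrightarrow> e' \<in> edges G \<Longrightarrow> e \<noteq> e' \<Longrightarrow>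
    path_image (curve G e) \<inter> path_image (curve G e') = vpos G ` (e \<inter> e')"
  by (simp add: plane_graph_def)

lemma arc_Int_sketch:
  assumes "plane_graph G" "e \<in> edges G" "T \<subseteq> edges G - {e}" "W \<subseteq> verts G"
  shows "path_image (curve G e) \<inter> sketch G W T \<subseteq> vpos G ` (e \<inter> (W \<union> \<Union>T))"
proof
  fix z assume z: "z \<in> path_image (curve G e) \<inter> sketch G W T"
  then consider v where "v \<in> W" "z = vpos G v" | e' where "e' \<in> T" "z \<in> path_image (curve G e')"
    by (auto simp: sketch_def)
  then show "z \<in> vpos G ` (e \<inter> (W \<union> \<Union>T))"
  proof cases
    case 1
    then have "z \<in> vpos G ` e" using z arc_Int_verts[OF assms(1,2)] assms(4) by blast
    then obtain v' where v': "v' \<in> e" "z = vpos G v'" by blast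
    moreover have "v' \<in> verts G" "inj_on (vpos G) (verts G)"
      using assms(1,2) v' unfolding plane_graph_def by blast+
    ultimately have "v = v'" using 1 assms(4) by (metis inj_onD subsetD)
    then have "v' \<in> e \<inter> (W \<union> \<Union>T)" using 1(1) v'(1) by simp
    then show ?thesis unfolding v'(2) by (rule imageI)
  next
    case 2
    then have "e' \<in> edges G" "e \<noteq> e'" using assms(3) by auto
    then have "z \<in> vpos G ` (e \<inter> e')" using arc_Int_arc[OF assms(1,2)] 2 z by blast
    moreover have "e \<inter> e' \<subseteq> e \<inter> (W \<union> \<Union>T)" using 2(1) by blast
    ultimately show ?thesis by (meson image_mono subsetD)
  qed
qed

lemma compact_sketch:
  assumes "plane_graph G" "T \<subseteq> edges G" "W \<subseteq> verts G"
  shows "compact (sketch G W T)"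
proof -
  have "finite W" "finite T" using assms plane_graph_finite[OF assms(1)] finite_subset by auto
  then show ?thesis unfolding sketch_def using assms
    by (intro compact_Un compact_UN finite_imp_compact ballI compact_arc_image plane_graph_arc) auto
qed

lemma interior_sketch:
  assumes "plane_graph G" "T \<subseteq> edges G" "W \<subseteq> verts G"
  shows "interior (sketch G W T) = {}"
proof -
  have fin: "finite W" "finite T"
    using assms plane_graph_finite[OF assms(1)] finite_subset by auto
  have "T \<subseteq> edges G \<longrightarrow> interior (vpos G ` W \<union> (\<Union>e\<in>T. path_image (curve G e))) = {}"
    using fin(2)
  proof (induction T rule: finite_induct)
    case empty
    have "interior (vpos G ` W) = {}"
      using fin(1) by (simp add: finite_imp_not_open interior_def) (metis finite_imp_not_open finite_imageI finite_subset)
    then show ?case by simp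
  next
    case (insert e T)
    have "vpos G ` W \<union> (\<Union>e\<in>insert e T. path_image (curve G e)) =
      path_image (curve G e) \<union> (vpos G ` W \<union> (\<Union>e\<in>T. path_image (curve G e)))" by auto
    then show ?case using insert assms(1)
      by (simp add: interior_closed_Un_empty_interior closed_arc_image interior_arc_empty plane_graph_arc)
  qed
  then show ?thesis using assms(2) by (simp add: sketch_def)
qed

lemma arc_inner_point:
  assumes "plane_graph G" "e \<in> edges G"
  obtains z where "z \<in> path_image (curve G e)" "z \<notin> vpos G ` verts G"
proof -
  have "path_image (curve G e) - vpos G ` e \<noteq> {}"
    using nonempty_simple_path_endless[of "curve G e"] assms
    by (metis arc_imp_simple_path plane_graph_arc plane_graph_ends)
  then show ?thesis using that arc_Int_verts[OF assms] by blast
qed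

lemma edge_frontier:
  assumes G: "plane_graph G" and T: "T \<subseteq> edges G" "e \<in> T" and W: "W \<subseteq> verts G"
    and f: "f \<in> components (- sketch G W T)"
    and p: "p \<in> frontier f" "p \<in> path_image (curve G e)" "p \<notin> vpos G ` verts G"
  shows "path_image (curve G e) \<subseteq> frontier f"
proof -
  have e: "e \<in> edges G" and ev: "e \<subseteq> verts G" using T G unfolding plane_graph_def by auto
  have eq: "sketch G W T = sketch G W (T - {e}) \<union> path_image (curve G e)"
    using T by (auto simp: sketch_def)
  have "path_image (curve G e) \<inter> sketch G W (T - {e}) \<subseteq> vpos G ` e"
    using arc_Int_sketch[OF G e, of "T - {e}" W] T W by blast
  moreover have "closed (sketch G W (T - {e}))"
    using G T W by (intro compact_imp_closed compact_sketch) auto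
  moreover have "p \<notin> vpos G ` e" using p ev by blast
  ultimately show ?thesis
    using p(2) by (intro arc_frontier[OF plane_graph_arc[OF G e] _ _ f[unfolded eq] p(1)])
      (simp_all only: plane_graph_ends[OF G e] Diff_iff simp_thms)
qed

lemma edge_in_sketch:
  assumes "plane_graph G" "T \<subseteq> edges G" "W \<subseteq> verts G" "e \<in> edges G"
    "path_image (curve G e) \<subseteq> sketch G W T"
  shows "e \<in> T"
proof (rule ccontr)
  assume "e \<notin> T"
  then have "T \<subseteq> edges G - {e}" using assms(2) by blast
  from arc_Int_sketch[OF assms(1,4) this assms(3)]
  have "path_image (curve G e) \<inter> sketch G W T \<subseteq> vpos G ` e" by blast
  moreover have "vpos G ` e \<subseteq> vpos G ` verts G"
    using arc_Int_verts[OF assms(1,4)] by blast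
  moreover obtain z where "z \<in> path_image (curve G e)" "z \<notin> vpos G ` verts G"
    using arc_inner_point[OF assms(1,4)] by blast
  ultimately show False using assms(5) by blast
qed

text \<open>
  Remove the leaves one by one: an arc that meets the rest in at most one point does not separate
  the plane, and neither does its union with a non-separating compact set, by Janiszewski's theorem.
  The hypothesis says that every nonempty set of edges has a leaf, so \<open>T\<close> is a forest.
\<close>

lemma connected_Compl_forest:
  assumes G: "plane_graph G" and T: "T \<subseteq> edges G" and W: "W \<subseteq> verts G"
    and forest: "\<forall>T'\<subseteq>T. T' \<noteq> {} \<longrightarrow> (\<exists>e\<in>T'. \<exists>v\<in>e. \<forall>e'\<in>T'. v \<in> e' \<longrightarrow> e' = e)"
  shows "connected (- sketch G W T)"
proof -
  have "finite T" by (rule finite_subset[OF T plane_graph_finite(2)[OF G]])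
  then show ?thesis using T W forest
  proof (induction T arbitrary: W rule: finite_psubset_induct)
    case (psubset T)
    show ?case
    proof (cases "T = {}")
      case True
      have "finite (vpos G ` W)"
        by (intro finite_imageI finite_subset[OF psubset.prems(2) plane_graph_finite(1)[OF G]])
      then show ?thesis
        using True path_connected_complement_countable[of "vpos G ` W"]
        by (simp add: sketch_def countable_finite path_connected_imp_connected)
    next
      case False
      then obtain e v where e: "e \<in> T" "v \<in> e" "\<And>e'. e' \<in> T \<Longrightarrow> v \<in> e' \<Longrightarrow> e' = e"
        using psubset.prems(3)[rule_format, OF order_refl False] by metis
      have eG: "e \<in> edges G" using e(1) psubset.prems(1) by blast
      then have "card e = 2" using G by (simp add: plane_graph_def)
      obtain u where u: "e = {v, u}" using \<open>card e = 2\<close> e(2) by (auto simp: card_2_iff)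
      let ?R = "sketch G (W - {v}) (T - {e})"
      have "path_image (curve G e) \<inter> ?R \<subseteq> vpos G ` (e \<inter> ((W - {v}) \<union> \<Union>(T - {e})))"
        using psubset.prems(1,2) by (intro arc_Int_sketch[OF G eG]) auto
      also have "\<dots> \<subseteq> {vpos G u}" using u e(3) by fastforce
      finally have con: "connected (path_image (curve G e) \<inter> ?R)"
        by (metis connected_empty connected_sing subset_singletonD)
      have cl: "closed ?R" using psubset.prems(1,2)
        by (intro compact_imp_closed compact_sketch[OF G]) auto
      have IH: "connected (- ?R)"
      proof (rule psubset.IH)
        show "T - {e} \<subset> T" "T - {e} \<subseteq> edges G" "W - {v} \<subseteq> verts G"
          using psubset.prems(1,2) e(1) by blast+
        show "\<forall>T'\<subseteq>T - {e}. T' \<noteq> {} \<longrightarrow> (\<exists>e\<in>T'. \<exists>v\<in>e. \<forall>e'\<in>T'. v \<in> e' \<longrightarrow> e' = e)"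
          using psubset.prems(3) by (meson Diff_subset subset_trans)
      qed
      have "vpos G v \<in> path_image (curve G e)" using arc_Int_verts[OF G eG] e(2) by blast
      then have eq: "sketch G W T = path_image (curve G e) \<union> ?R"
        using e(1) by (auto simp: sketch_def)
      show ?thesis unfolding eq
        using plane_graph_arc[OF G eG]
        by (intro Janiszewski_connected con cl IH compact_arc_image connected_arc_complement) auto
    qed
  qed
qed

section \<open>The boundary of a face\<close>

lemma bounded_component_disconnects:
  fixes K :: "complex set"
  assumes "compact K" "f \<in> components (- K)" "bounded f"
  shows "\<not> connected (- K)"
proof
  assume "connected (- K)"
  moreover have "- K \<noteq> {}" using assms(2) by force
  ultimately have "components (- K) = {- K}" by (simp add: components_eq_sing_iff)
  then show False
    using assms cobounded_unbounded_components[of "- K"] by (auto simp: compact_imp_bounded)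
qed

lemma drawing_eq_sketch: "drawing G = sketch G (verts G) (edges G)"
  by (simp add: drawing_def sketch_def)

lemma face_edges_subset: "face_edges G f \<subseteq> edges G" and face_verts_subset: "face_verts G f \<subseteq> verts G"
  by (auto simp: face_edges_def face_verts_def)

text \<open>
  This combines \<open>edge_frontier\<close> over all edges; it lets a face be studied through its own boundary
  edges alone.
\<close>

lemma frontier_face:
  assumes G: "plane_graph G" and f: "f \<in> faces G"
  shows "frontier f \<subseteq> sketch G (face_verts G f) (face_edges G f)"
proof
  fix z assume z: "z \<in> frontier f"
  have f': "f \<in> components (- sketch G (verts G) (edges G))"
    using f by (simp add: faces_def drawing_eq_sketch)
  have "z \<in> sketch G (verts G) (edges G)"
    using z f' compact_imp_closed[OF compact_sketch[OF G order_refl order_refl]]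
      frontier_of_components_closed_complement by blast
  then consider v where "v \<in> verts G" "z = vpos G v"
    | e where "e \<in> edges G" "z \<in> path_image (curve G e)" "z \<notin> vpos G ` verts G"
    by (auto simp: sketch_def)
  then show "z \<in> sketch G (face_verts G f) (face_edges G f)"
  proof cases
    case 1 then show ?thesis using z by (auto simp: sketch_def face_verts_def)
  next
    case 2 
    then have "e \<in> face_edges G f"
      using edge_frontier[OF G order_refl 2(1) order_refl f' z] by (simp add: face_edges_def)
    with 2 show ?thesis by (auto simp: sketch_def)
  qed
qed

lemma face_component:
  assumes G: "plane_graph G" and f: "f \<in> faces G"
  shows "f \<in> components (- sketch G (face_verts G f) (face_edges G f))"
  using f component_subset_Compl[OF _ frontier_face[OF G f], of "drawing G"]
  by (auto simp: faces_def drawing_def sketch_def face_edges_def face_verts_def)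

text \<open>
  Walking from a black corner to both sides never meets a leaf, and with at most four edges
  available the two walks have to meet again at the opposite black corner.
\<close>

lemma bipartite_four_cycle:
  assumes T: "finite T" "card T \<le> 4" and T': "T' \<subseteq> T" "T' \<noteq> {}"
    and bip: "\<And>e. e \<in> T \<Longrightarrow> \<exists>b\<in>B. \<exists>w\<in>W. e = {b, w}" and BW: "B \<inter> W = {}"
    and deg: "\<And>e v. e \<in> T' \<Longrightarrow> v \<in> e \<Longrightarrow> \<exists>e'\<in>T'. v \<in> e' \<and> e' \<noteq> e"
  shows "\<exists>x y u v. x \<in> B \<and> y \<in> B \<and> u \<in> W \<and> v \<in> W \<and> x \<noteq> y \<and> u \<noteq> v \<and>
           T = {{x, u}, {u, y}, {y, v}, {v, x}}"
proof -
  have eqI: "b = b' \<and> w = w'" if "{b, w} = {b', w'}" "b \<in> B" "b' \<in> B" "w \<in> W" "w' \<in> W" for b b' w w'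
    using that BW by (auto simp: doubleton_eq_iff)
  have stepB: "\<exists>w'\<in>W. w' \<noteq> w \<and> {b, w'} \<in> T'" if bw: "b \<in> B" "w \<in> W" "{b, w} \<in> T'" for b w
  proof -
    obtain e' where e': "e' \<in> T'" "b \<in> e'" "e' \<noteq> {b, w}" using deg[OF bw(3), of b] by auto
    moreover obtain b' w' where "b' \<in> B" "w' \<in> W" "e' = {b', w'}" using bip e' T' by blast
    ultimately show ?thesis using BW bw by auto
  qed
  have stepW: "\<exists>b'\<in>B. b' \<noteq> b \<and> {b', w} \<in> T'" if bw: "b \<in> B" "w \<in> W" "{b, w} \<in> T'" for b w
  proof -
    obtain e' where e': "e' \<in> T'" "w \<in> e'" "e' \<noteq> {b, w}" using deg[OF bw(3), of w] by auto
    moreover obtain b' w' where "b' \<in> B" "w' \<in> W" "e' = {b', w'}" using bip e' T' by blast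
    ultimately show ?thesis using BW bw by auto
  qed
  obtain x u where 1: "x \<in> B" "u \<in> W" "{x, u} \<in> T'" using T' bip by blast
  obtain y where 2: "y \<in> B" "y \<noteq> x" "{y, u} \<in> T'" using stepW[OF 1] by blast
  obtain v where 3: "v \<in> W" "v \<noteq> u" "{x, v} \<in> T'" using stepB[OF 1] by blast
  obtain z where 4: "z \<in> B" "z \<noteq> x" "{z, v} \<in> T'" using stepW[OF 1(1) 3(1,3)] by blast
  obtain t where 5: "t \<in> W" "t \<noteq> u" "{y, t} \<in> T'" using stepB[OF 2(1) 1(2) 2(3)] by blast
  have ne: "x \<noteq> u" "x \<noteq> v" "x \<noteq> t" "y \<noteq> u" "y \<noteq> v" "y \<noteq> t" "z \<noteq> u" "z \<noteq> v" "z \<noteq> t"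
    using BW 1 2 3 4 5 by auto
  have "z = y"
  proof (rule ccontr)
    assume "z \<noteq> y"
    then have "card {{x, u}, {y, u}, {x, v}, {z, v}, {y, t}} = 5"
      using ne 2 3 4 5 by (auto simp: doubleton_eq_iff card_insert_if)
    moreover have "card {{x, u}, {y, u}, {x, v}, {z, v}, {y, t}} \<le> card T"
      using T T' 1 2 3 4 5 by (intro card_mono) auto
    ultimately show False using T by linarith
  qed
  have "{{x, u}, {y, u}, {x, v}, {y, v}} = T"
  proof (rule card_seteq)
    have "card {{x, u}, {y, u}, {x, v}, {y, v}} = 4"
      using ne 2 3 by (auto simp: doubleton_eq_iff card_insert_if)
    then show "card T \<le> card {{x, u}, {y, u}, {x, v}, {y, v}}" using T by simp
  qed (use T T' 1 2 3 4 \<open>z = y\<close> in auto)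
  then have "T = {{x, u}, {u, y}, {y, v}, {v, x}}" by (auto simp: insert_commute)
  then show ?thesis using 1 2 3 by blast
qed

text \<open>
  The at most four boundary edges separate the bounded face from infinity, hence do not form a
  forest, and the only non-forest with at most four edges in a bipartite simple graph is a 4-cycle.
\<close>

lemma face_four_cycle:
  assumes G: "plane_graph G" and bip: "bipartite_colouring G B"
    and f: "f \<in> internal_faces G" "face_degree G f = 4"
  shows "\<exists>x y u v. x \<in> B \<and> y \<in> B \<and> u \<in> verts G - B \<and> v \<in> verts G - B \<and> x \<noteq> y \<and> u \<noteq> v \<and>
           face_edges G f = {{x, u}, {u, y}, {y, v}, {v, x}}"
proof -
  let ?T = "face_edges G f"
  have fin: "finite ?T" using finite_subset[OF face_edges_subset plane_graph_finite(2)[OF G]] .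
  have "card ?T = (\<Sum>e\<in>?T. 1)" by simp
  also have "\<dots> \<le> face_degree G f" unfolding face_degree_def by (rule sum_mono) auto
  finally have card: "card ?T \<le> 4" using f by simp
  have ff: "f \<in> faces G" "bounded f" using f by (auto simp: internal_faces_def)
  have "\<not> connected (- sketch G (face_verts G f) ?T)"
    using bounded_component_disconnects[OF compact_sketch[OF G face_edges_subset face_verts_subset]
      face_component[OF G ff(1)] ff(2)] .
  then obtain T' where T': "T' \<subseteq> ?T" "T' \<noteq> {}" "\<And>e v. e \<in> T' \<Longrightarrow> v \<in> e \<Longrightarrow> \<exists>e'\<in>T'. v \<in> e' \<and> e' \<noteq> e"
    using connected_Compl_forest[OF G face_edges_subset[of G f] face_verts_subset[of G f]] by metis
  show ?thesis
  proof (rule bipartite_four_cycle[OF fin card T'(1,2) _ _ T'(3)])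
    show "\<exists>b\<in>B. \<exists>w\<in>verts G - B. e = {b, w}" if "e \<in> ?T" for e
      using that bip face_edges_subset unfolding bipartite_colouring_def by blast
  qed auto
qed

text \<open>
  If no edge of \<open>f\<close> ended at \<open>v\<close>, then no boundary point of \<open>f\<close> other than \<open>v\<close> would be near \<open>v\<close>, and
  \<open>f\<close> would contain a punctured disc around \<open>v\<close>. But some edge of the connected graph starts at \<open>v\<close>.
\<close>

lemma vertex_on_face_edge:
  assumes G: "plane_graph G" and con: "graph_connected G" and ne: "edges G \<noteq> {}"
    and f: "f \<in> faces G" and v: "v \<in> face_verts G f"
  shows "v \<in> \<Union>(face_edges G f)"
proof (rule ccontr)
  assume nv: "v \<notin> \<Union>(face_edges G f)"
  have vV: "v \<in> verts G" and vf: "vpos G v \<in> frontier f" using v by (auto simp: face_verts_def)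
  let ?R = "sketch G (face_verts G f - {v}) (face_edges G f)"
  have cl: "closed ?R"
    using face_edges_subset[of G f] face_verts_subset[of G f]
    by (intro compact_imp_closed compact_sketch[OF G]) auto
  have vR: "vpos G v \<notin> ?R"
  proof
    assume "vpos G v \<in> ?R"
    then consider u where "u \<in> verts G" "u \<noteq> v" "vpos G v = vpos G u"
      | e where "e \<in> face_edges G f" "vpos G v \<in> path_image (curve G e)"
      using face_verts_subset[of G f] by (auto simp: sketch_def)
    then show False
    proof cases
      case 1 then show False using G vV unfolding plane_graph_def inj_on_def by metis
    next
      case 2
      then have e: "e \<in> edges G" using face_edges_subset by blast
      then have "vpos G v \<in> vpos G ` e" using arc_Int_verts[OF G e] 2 vV by blast
      moreover have "e \<subseteq> verts G" "inj_on (vpos G) (verts G)" using G e unfolding plane_graph_def by blast+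
      ultimately have "v \<in> e" using vV by (metis inj_on_image_mem_iff)
      then show False using nv 2 by blast
    qed
  qed
  obtain e where e: "e \<in> edges G" "v \<in> e"
  proof -
    obtain e0 where e0: "e0 \<in> edges G" using ne by blast
    then obtain w where w: "w \<in> e0" "w \<in> verts G" using G unfolding plane_graph_def
      by (metis card.empty equals0I subsetD zero_neq_numeral)
    show ?thesis
    proof (cases "w = v")
      case False
      have "(v, w) \<in> {(p, q). {p, q} \<in> edges G}\<^sup>*" using con vV w by (simp add: graph_connected_def)
      then obtain q where "{v, q} \<in> edges G" using False by (auto elim: converse_rtranclE)
      then show ?thesis using that by blast
    qed (use that e0 w in blast)
  qed
  obtain r where r: "r > 0" "ball (vpos G v) r \<subseteq> - ?R"
    using cl vR by (metis ComplI open_Compl open_contains_ball_eq)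
  let ?P = "ball (vpos G v) r - {vpos G v}"
  have fdis: "f \<inter> drawing G = {}" using f in_components_subset unfolding faces_def by blast
  have vd: "vpos G v \<in> drawing G" using vV by (auto simp: drawing_def)
  have "frontier f \<subseteq> ?R \<union> {vpos G v}" using frontier_face[OF G f] by (auto simp: sketch_def)
  then have "?P \<inter> frontier f = {}" using r by blast
  moreover have "connected ?P" by (rule connected_open_diff_countable) auto
  moreover have "?P \<inter> f \<noteq> {}"
  proof -
    have "vpos G v \<in> closure f" using vf by (simp add: frontier_def)
    then obtain y where "y \<in> f" "dist y (vpos G v) < r" using r closure_approachable by blast
    then show ?thesis using fdis vd by (auto simp: dist_commute)
  qed
  ultimately have Pf: "?P \<subseteq> f" using connected_Int_frontier by blast
  have "vpos G v islimpt path_image (curve G e)"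
  proof (rule connected_imp_perfect)
    show "connected (path_image (curve G e))" "vpos G v \<in> path_image (curve G e)"
      using arc_Int_verts[OF G e(1)] e plane_graph_arc[OF G e(1)] connected_arc_image by auto
    show "path_image (curve G e) \<noteq> {x}" for x
      using plane_graph_arc[OF G e(1)] arc_distinct_ends pathstart_in_path_image pathfinish_in_path_image
      by (metis singletonD)
  qed
  then obtain z where "z \<in> path_image (curve G e)" "z \<noteq> vpos G v" "dist z (vpos G v) < r"
    using r by (auto simp: islimpt_approachable)
  then have "z \<in> ?P" "z \<in> drawing G" using e by (auto simp: drawing_def dist_commute)
  then show False using Pf fdis by blast
qed

lemma face_verts_eq:
  assumes G: "plane_graph G" and con: "graph_connected G" and ne: "edges G \<noteq> {}" and f: "f \<in> faces G"
  shows "face_verts G f = \<Union>(face_edges G f)"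
proof
  show "face_verts G f \<subseteq> \<Union>(face_edges G f)" using vertex_on_face_edge[OF assms] by blast
  show "\<Union>(face_edges G f) \<subseteq> face_verts G f"
  proof
    fix v assume "v \<in> \<Union>(face_edges G f)"
    then obtain e where e: "e \<in> edges G" "path_image (curve G e) \<subseteq> frontier f" "v \<in> e"
      by (auto simp: face_edges_def)
    then have "v \<in> verts G" "vpos G v \<in> path_image (curve G e)"
      using G arc_Int_verts[OF G e(1)] unfolding plane_graph_def by blast+
    then show "v \<in> face_verts G f" using e by (auto simp: face_verts_def)
  qed
qed

section \<open>Exactness of closed forms\<close>

text \<open>
  The plane without the vertices is connected and contains both outer and bounded regions, hence
  has a point on the boundary of the closed outer region. Such a point is inside an edge, and some
  region other than the outer one comes arbitrarily close to it.
\<close>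

lemma edge_between_inner_and_outer:
  assumes G: "plane_graph G" and T: "T \<subseteq> edges G"
    and f0: "f0 \<in> components (- sketch G (verts G) T)" "bounded f0"
  obtains e f U where "e \<in> T" "f \<in> components (- sketch G (verts G) T)" "bounded f"
    "path_image (curve G e) \<subseteq> frontier f"
    "U \<in> components (- sketch G (verts G) T)" "\<not> bounded U" "path_image (curve G e) \<subseteq> frontier U"
proof -
  let ?K = "sketch G (verts G) T"
  have K: "compact ?K" using compact_sketch[OF G T] by blast
  then have clK: "closed ?K" by (rule compact_imp_closed)
  have opc: "open C" if "C \<in> components (- ?K)" for C
    using open_components[OF _ that] clK by blast
  obtain U where U: "U \<in> components (- ?K)" "\<not> bounded U"
    using cobounded_unbounded_components[of "- ?K"] K compact_imp_bounded by auto
  have disj: "C \<inter> closure U = {}" if "C \<in> components (- ?K)" "C \<noteq> U" for C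
    using open_Int_closure_eq_empty[OF opc[OF that(1)]] components_nonoverlap that U(1) by metis
  have ne: "C \<noteq> {}" "C \<subseteq> - ?K" if "C \<in> components (- ?K)" for C
    using that in_components_nonempty in_components_subset by blast+
  let ?P = "- (vpos G ` verts G)"
  have con: "connected ?P"
    using path_connected_complement_countable[of "vpos G ` verts G"] plane_graph_finite(1)[OF G]
    by (simp add: countable_finite path_connected_imp_connected)
  have KP: "- ?K \<subseteq> ?P" by (auto simp: sketch_def)
  have "?P \<inter> closure U \<noteq> {}" using ne[OF U(1)] KP closure_subset[of U] by blast
  moreover have "?P - closure U \<noteq> {}"
  proof -
    have "f0 \<noteq> U" using U f0 by blast
    then show ?thesis using disj[OF f0(1)] ne[OF f0(1)] KP by blast
  qed
  ultimately have "?P \<inter> frontier (closure U) \<noteq> {}" by (rule connected_Int_frontier[OF con])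
  then obtain p where p: "p \<in> ?P" "p \<in> frontier (closure U)" by blast
  have pU: "p \<in> closure U" "p \<notin> interior (closure U)" using p(2) by (auto simp: frontier_def)
  have "U \<subseteq> interior (closure U)" by (rule interior_maximal[OF closure_subset opc[OF U(1)]])
  then have pfr: "p \<in> frontier U" using pU opc[OF U(1)] by (auto simp: frontier_def interior_open)
  then have "p \<in> ?K" using frontier_of_components_closed_complement[OF clK U(1)] by blast
  then obtain e where e: "e \<in> T" "p \<in> path_image (curve G e)" using p(1) by (auto simp: sketch_def)
  have eG: "e \<in> edges G" using e T by blast
  let ?R = "sketch G (verts G) (T - {e})"
  have clR: "closed ?R" using T by (intro compact_imp_closed compact_sketch[OF G]) auto
  have KR: "?K = ?R \<union> path_image (curve G e)" using e by (auto simp: sketch_def)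
  have "p \<notin> ?R"
  proof
    assume "p \<in> ?R"
    then obtain e' where e': "e' \<in> T - {e}" "p \<in> path_image (curve G e')"
      using p(1) by (auto simp: sketch_def)
    then have "p \<in> vpos G ` (e \<inter> e')" using arc_Int_arc[OF G eG, of e'] T e by blast
    moreover have "e \<subseteq> verts G" using G eG by (simp add: plane_graph_def)
    ultimately show False using p(1) by blast
  qed
  then obtain r where r: "r > 0" "ball p r \<subseteq> - ?R"
    using clR by (metis ComplI open_Compl open_contains_ball_eq)
  have "\<not> ball p r \<subseteq> closure U" using pU(2) r(1) by (meson mem_interior)
  then have "ball p r \<inter> - closure U \<noteq> {}" by blast
  moreover have "open (ball p r \<inter> - closure U)" by auto
  ultimately have "\<not> ball p r \<inter> - closure U \<subseteq> ?K"
    using interior_sketch[OF G T order_refl] by (metis interior_maximal subset_empty)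
  then obtain z where z: "z \<in> ball p r" "z \<notin> closure U" "z \<in> - ?K" by blast
  then obtain f where f: "f \<in> components (- ?K)" "z \<in> f" by (metis UnionE Union_components)
  have bf: "bounded f"
  proof (rule ccontr)
    assume "\<not> bounded f"
    then have "f = U" using cobounded_unique_unbounded_components[of "- ?K" U f] U f(1) K
      by (simp add: compact_imp_bounded)
    then show False using f(2) z(2) closure_subset by blast
  qed
  have pr: "p \<in> ball p r" using r(1) by simp
  have "p \<notin> f" using ne(2)[OF f(1)] \<open>p \<in> ?K\<close> by blast
  then have "ball p r \<inter> f \<noteq> {}" "ball p r - f \<noteq> {}" using pr z(1) f(2) by blast+
  then have "ball p r \<inter> frontier f \<noteq> {}" by (rule connected_Int_frontier[OF connected_ball])
  then obtain q where q: "q \<in> ball p r" "q \<in> frontier f" by blast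
  then have "q \<in> ?K" using frontier_of_components_closed_complement[OF clK f(1)] by blast
  moreover have "q \<notin> ?R" using q(1) r(2) by blast
  ultimately have qe: "q \<in> path_image (curve G e)" "q \<notin> vpos G ` verts G"
    unfolding KR by (auto simp: sketch_def)
  have "path_image (curve G e) \<subseteq> frontier f"
    by (rule edge_frontier[OF G T e(1) order_refl f(1) q(2) qe])
  moreover have "path_image (curve G e) \<subseteq> frontier U"
    by (rule edge_frontier[OF G T e(1) order_refl U(1) pfr e(2)]) (use p in blast)
  ultimately show ?thesis using that e(1) f(1) bf U by blast
qed

text \<open>
  Erasing an edge of the outer region merges the regions on its two sides into an unbounded one, and
  leaves the other regions alone.
\<close>

lemma bounded_components_remove_outer_edge:
  assumes U: "U \<in> components (- K)" "\<not> bounded U" "A \<subseteq> frontier U"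
    and K: "closed K'" "K = K' \<union> A"
    and C: "C \<in> components (- K')" "bounded C"
  shows "C \<in> components (- (K :: complex set))"
proof -
  have opC: "open C" using open_components[OF _ C(1)] K by blast
  have "C \<inter> A = {}"
  proof (rule ccontr)
    assume "C \<inter> A \<noteq> {}"
    then have "C \<inter> closure U \<noteq> {}" using U(3) by (auto simp: frontier_def)
    then have "C \<inter> U \<noteq> {}" using open_Int_closure_eq_empty[OF opC] by blast
    moreover have "U \<subseteq> - K'" "connected U"
      using in_components_subset[OF U(1)] in_components_connected[OF U(1)] K by auto
    ultimately have "U \<subseteq> C" using components_maximal[OF C(1)] by blast
    then show False using U(2) C(2) bounded_subset by blast
  qed
  then have CK: "C \<subseteq> - K" using in_components_subset[OF C(1)] K by blast
  then obtain D where D: "D \<in> components (- K)" "C \<subseteq> D"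
    using exists_component_superset[of C "- K"] in_components_nonempty[OF C(1)] in_components_connected[OF C(1)]
    by blast
  have "D \<subseteq> - K'" using in_components_subset[OF D(1)] K by blast
  moreover have "C \<inter> D \<noteq> {}" using D in_components_nonempty[OF C(1)] by blast
  ultimately have "D \<subseteq> C" using components_maximal[OF C(1) in_components_connected[OF D(1)]] by blast
  with D show ?thesis by simp
qed

lemma path_component_sketch:
  assumes G: "plane_graph G" and T: "T \<subseteq> edges G" and r: "(a, b) \<in> (adj T)\<^sup>*" and a: "a \<in> verts G"
  shows "path_component (sketch G (verts G) T) (vpos G a) (vpos G b)"
  using r
proof (induction rule: rtrancl_induct)
  case base
  show ?case using a by (intro path_component_refl) (auto simp: sketch_def)
next
  case (step p q)
  then have e: "{p, q} \<in> T" "{p, q} \<in> edges G" using T by (auto simp: adj_def)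
  have "path_connected (path_image (curve G {p, q}))"
    using plane_graph_arc[OF G e(2)] arc_imp_path by (intro path_connected_path_image) blast
  moreover have "vpos G p \<in> path_image (curve G {p, q})" "vpos G q \<in> path_image (curve G {p, q})"
    using arc_Int_verts[OF G e(2)] by auto
  ultimately have "path_component (path_image (curve G {p, q})) (vpos G p) (vpos G q)"
    by (simp add: path_connected_component)
  then have "path_component (sketch G (verts G) T) (vpos G p) (vpos G q)"
    by (rule path_component_of_subset[rotated]) (use e in \<open>auto simp: sketch_def\<close>)
  with step.IH show ?case by (rule path_component_trans)
qed

text \<open>
  A path from \<open>a\<close> to \<open>b\<close> that avoids the edge \<open>{a, b}\<close> closes up with it to a Jordan curve. Its inside is
  open, so it is not covered by the drawing and contains a bounded region.
\<close>

lemma bridge_if_no_bounded_component: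
  assumes G: "plane_graph G" and T: "T \<subseteq> edges G" and e: "{a, b} \<in> T"
    and unb: "\<And>C. C \<in> components (- sketch G (verts G) T) \<Longrightarrow> \<not> bounded C"
  shows "(a, b) \<notin> (adj (T - {{a, b}}))\<^sup>*"
proof
  assume r: "(a, b) \<in> (adj (T - {{a, b}}))\<^sup>*"
  let ?e = "{a, b}" and ?c = "curve G {a, b}"
  let ?R = "sketch G (verts G) (T - {?e})" and ?K = "sketch G (verts G) T"
  have eG: "?e \<in> edges G" using e T by blast
  have ab: "a \<noteq> b" "a \<in> verts G" "b \<in> verts G" using plane_graph_edge[OF G eG] by auto
  then have vab: "vpos G a \<noteq> vpos G b" using plane_graph_inj[OF G] by (simp add: inj_on_eq_iff)
  have "path_component ?R (vpos G a) (vpos G b)"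
    using path_component_sketch[OF G _ r ab(2)] T by blast
  then obtain p where p: "path p" "path_image p \<subseteq> ?R" "pathstart p = vpos G a" "pathfinish p = vpos G b"
    by (auto simp: path_component_def)
  obtain q where q: "arc q" "path_image q \<subseteq> path_image p" "pathstart q = vpos G a" "pathfinish q = vpos G b"
    using path_contains_arc[OF p(1,3,4) vab] by blast
  have c: "arc ?c" using plane_graph_arc[OF G eG] .
  have ends: "{pathstart ?c, pathfinish ?c} = {vpos G a, vpos G b}" using plane_graph_ends[OF G eG] by simp
  obtain h where h: "arc h" "path_image h = path_image ?c" "pathstart h = vpos G b" "pathfinish h = vpos G a"
  proof (cases "pathstart ?c = vpos G b")
    case True
    then have "pathfinish ?c = vpos G a" using ends vab by (auto simp: doubleton_eq_iff)
    then show ?thesis using that[of ?c] c True by blast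
  next
    case False
    then have "pathstart ?c = vpos G a" "pathfinish ?c = vpos G b" using ends by (auto simp: doubleton_eq_iff)
    then show ?thesis using that[of "reversepath ?c"] c by (simp add: arc_reversepath)
  qed
  have sub: "path_image q \<subseteq> ?R" using q(2) p(2) by blast
  have "path_image ?c \<inter> ?R \<subseteq> vpos G ` (?e \<inter> (verts G \<union> \<Union>(T - {?e})))"
    using T by (intro arc_Int_sketch[OF G eG]) auto
  then have "path_image q \<inter> path_image h \<subseteq> {pathstart q, pathstart h}"
    using sub h q by auto
  then have J: "simple_path (q +++ h)" "pathfinish (q +++ h) = pathstart (q +++ h)"
    using q h by (auto intro!: simple_path_join_loop)
  let ?J = "path_image (q +++ h)"
  have "path_image ?c \<subseteq> ?K" "?R \<subseteq> ?K" using e by (auto simp: sketch_def)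
  then have JK: "?J \<subseteq> ?K" using q h sub by (auto simp: path_image_join)
  note Jio = Jordan_inside_outside[OF J]
  have "\<not> inside ?J \<subseteq> ?K"
    using Jio interior_sketch[OF G T order_refl] by (metis interior_maximal subset_empty)
  then obtain z where z: "z \<in> inside ?J" "z \<in> - ?K" by blast
  then obtain C where C: "C \<in> components (- ?K)" "z \<in> C" by (metis UnionE Union_components)
  have "C \<inter> frontier (inside ?J) = {}" using in_components_subset[OF C(1)] JK Jio by blast
  moreover have "C \<inter> inside ?J \<noteq> {}" using C(2) z(1) by blast
  ultimately have "C \<subseteq> inside ?J"
    using connected_Int_frontier[OF in_components_connected[OF C(1)], of "inside ?J"] by blast
  then show False using unb[OF C(1)] Jio bounded_subset by blast
qed

text \<open>
  Add the edges one at a time. A new edge joins two different components, so the potential can be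
  shifted on one of them to fit the new edge.
\<close>

lemma forest_potential:
  fixes k :: "'v set \<Rightarrow> real"
  assumes "finite S" and "\<And>e. e \<in> S \<Longrightarrow> \<exists>b\<in>B. \<exists>w. w \<notin> B \<and> e = {b, w}"
    and "\<And>b w. {b, w} \<in> S \<Longrightarrow> (b, w) \<notin> (adj (S - {{b, w}}))\<^sup>*"
  shows "\<exists>h. \<forall>b\<in>B. \<forall>w. w \<notin> B \<longrightarrow> {b, w} \<in> S \<longrightarrow> h b - h w = k {b, w}"
  using assms
proof (induction S rule: finite_induct)
  case empty
  then show ?case by simp
next
  case (insert e S)
  have "(b, w) \<notin> (adj (S - {{b, w}}))\<^sup>*" if "{b, w} \<in> S" for b w
  proof -
    have "adj (S - {{b, w}}) \<subseteq> adj (insert e S - {{b, w}})" by (auto simp: adj_def)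
    then show ?thesis using insert.prems(2)[of b w] that rtrancl_mono by blast
  qed
  moreover have "\<exists>b\<in>B. \<exists>w. w \<notin> B \<and> e' = {b, w}" if "e' \<in> S" for e' using insert.prems(1) that by blast
  ultimately obtain h where h: "\<And>b w. b \<in> B \<Longrightarrow> w \<notin> B \<Longrightarrow> {b, w} \<in> S \<Longrightarrow> h b - h w = k {b, w}"
    using insert.IH by metis
  obtain x u where xu: "x \<in> B" "u \<notin> B" "e = {x, u}" using insert.prems(1)[of e] by blast
  have sym: "sym ((adj S)\<^sup>*)" by (rule sym_rtrancl) (auto simp: sym_def adj_def insert_commute)
  have "insert e S - {{x, u}} = S" using insert.hyps(2) xu by auto
  then have "(x, u) \<notin> (adj S)\<^sup>*" using insert.prems(2)[of x u] xu by simp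
  then have nx: "(u, x) \<notin> (adj S)\<^sup>*" using sym by (meson symD)
  \<comment> \<open>shift the component of \<open>u\<close> by the defect of \<open>h\<close> on the new edge\<close>
  define h' where "h' z = (if (u, z) \<in> (adj S)\<^sup>* then h z - (k e - (h x - h u)) else h z)" for z
  have "h' b - h' w = k {b, w}" if bw: "b \<in> B" "w \<notin> B" "{b, w} \<in> insert e S" for b w
  proof (cases "{b, w} = e")
    case True
    then have "b = x" "w = u" using xu bw by (auto simp: doubleton_eq_iff)
    then show ?thesis using nx xu by (simp add: h'_def)
  next
    case False
    then have S: "{b, w} \<in> S" using bw by blast
    then have "(b, w) \<in> adj S" "(w, b) \<in> adj S" by (auto simp: adj_def insert_commute)
    then have "(u, b) \<in> (adj S)\<^sup>* \<longleftrightarrow> (u, w) \<in> (adj S)\<^sup>*" by (meson rtrancl.rtrancl_into_rtrancl)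
    then show ?thesis using h[OF bw(1,2) S] by (simp add: h'_def)
  qed
  then show ?case by blast
qed

text \<open>
  The discrete Poincare lemma: a form \<open>k\<close> on the edges, oriented from white to black, that is closed
  around every bounded face is the differential of a function \<open>h\<close>. Edges that separate a bounded face
  from the outer region are removed one at a time. The closedness on that face recovers
  the equation for the removed edge from those for its other three edges, so orientations of faces
  and cycles never enter. When no bounded face is left, the graph is a forest.
\<close>

lemma closed_form_exact:
  fixes k :: "'v set \<Rightarrow> real"
  assumes G: "plane_graph G" and bip: "bipartite_colouring G B"
    and closed: "\<And>f. f \<in> internal_faces G \<Longrightarrow> \<exists>x y u v. x \<in> B \<and> y \<in> B \<and> u \<in> verts G - B \<and> v \<in> verts G - B \<and>
      x \<noteq> y \<and> u \<noteq> v \<and> face_edges G f = {{x, u}, {u, y}, {y, v}, {v, x}} \<and>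
      k {x, u} + k {y, v} = k {u, y} + k {v, x}"
  shows "\<exists>h. \<forall>b\<in>B. \<forall>w. w \<notin> B \<longrightarrow> {b, w} \<in> edges G \<longrightarrow> h b - h w = k {b, w}"
proof -
  have "\<exists>h. \<forall>b\<in>B. \<forall>w. w \<notin> B \<longrightarrow> {b, w} \<in> S \<longrightarrow> h b - h w = k {b, w}"
    if "S \<subseteq> edges G" "\<forall>C\<in>components (- sketch G (verts G) S). bounded C \<longrightarrow> C \<in> internal_faces G" for S
    using finite_subset[OF that(1) plane_graph_finite(2)[OF G]] that
  proof (induction S rule: finite_psubset_induct)
    case (psubset S)
    note S = psubset.prems(1)
    show ?case
    proof (cases "\<exists>C\<in>components (- sketch G (verts G) S). bounded C")
      case False
      show ?thesis
      proof (rule forest_potential[OF psubset.hyps])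
        show "\<exists>b\<in>B. \<exists>w. w \<notin> B \<and> e = {b, w}" if "e \<in> S" for e
          using that bip S unfolding bipartite_colouring_def by blast
        show "(b, w) \<notin> (adj (S - {{b, w}}))\<^sup>*" if "{b, w} \<in> S" for b w
          using bridge_if_no_bounded_component[OF G S that] False by blast
      qed
    next
      case True
      then obtain e f U where e: "e \<in> S" and f: "f \<in> components (- sketch G (verts G) S)" "bounded f"
        "path_image (curve G e) \<subseteq> frontier f"
        and U: "U \<in> components (- sketch G (verts G) S)" "\<not> bounded U" "path_image (curve G e) \<subseteq> frontier U"
        using edge_between_inner_and_outer[OF G S] by blast
      have fi: "f \<in> internal_faces G" using psubset.prems(2) f by blast
      have cl: "closed (sketch G (verts G) (S - {e}))" "closed (sketch G (verts G) S)"
        using S by (intro compact_imp_closed compact_sketch[OF G]; auto)+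
      have KR: "sketch G (verts G) S = sketch G (verts G) (S - {e}) \<union> path_image (curve G e)"
        using e by (auto simp: sketch_def)
      have "\<exists>h. \<forall>b\<in>B. \<forall>w. w \<notin> B \<longrightarrow> {b, w} \<in> S - {e} \<longrightarrow> h b - h w = k {b, w}"
      proof (rule psubset.IH)
        show "S - {e} \<subset> S" "S - {e} \<subseteq> edges G" using S e by auto
        show "\<forall>C\<in>components (- sketch G (verts G) (S - {e})). bounded C \<longrightarrow> C \<in> internal_faces G"
          using bounded_components_remove_outer_edge[OF U cl(1) KR] psubset.prems(2) by blast
      qed
      then obtain h where h: "\<And>b w. b \<in> B \<Longrightarrow> w \<notin> B \<Longrightarrow> {b, w} \<in> S - {e} \<Longrightarrow> h b - h w = k {b, w}"
        by metis
      obtain x y u v where xy: "x \<in> B" "y \<in> B" "u \<in> verts G - B" "v \<in> verts G - B" "x \<noteq> y" "u \<noteq> v"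
        and fe: "face_edges G f = {{x, u}, {u, y}, {y, v}, {v, x}}"
        and k: "k {x, u} + k {y, v} = k {u, y} + k {v, x}"
        using closed[OF fi] by blast
      have feS: "face_edges G f \<subseteq> S"
      proof
        fix e' assume "e' \<in> face_edges G f"
        then have "e' \<in> edges G" "path_image (curve G e') \<subseteq> sketch G (verts G) S"
          using frontier_of_components_closed_complement[OF cl(2) f(1)] by (auto simp: face_edges_def)
        then show "e' \<in> S" using edge_in_sketch[OF G S order_refl] by blast
      qed
      have "e \<in> face_edges G f" using e f S by (auto simp: face_edges_def)
      then have e4: "e = {x, u} \<or> e = {y, u} \<or> e = {y, v} \<or> e = {x, v}"
        using fe by (auto simp: insert_commute)
      have S4: "{x, u} \<in> S" "{y, u} \<in> S" "{y, v} \<in> S" "{x, v} \<in> S" using feS fe by (auto simp: insert_commute)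
      have d: "{b, w} = {b', w'} \<longleftrightarrow> b = b' \<and> w = w'" if "b \<in> B" "b' \<in> B" "w \<notin> B" "w' \<notin> B" for b b' w w'
        using that by (auto simp: doubleton_eq_iff)
      have k': "k {x, u} + k {y, v} = k {y, u} + k {x, v}" using k by (simp add: insert_commute)
      have nB: "u \<notin> B" "v \<notin> B" using xy by auto
      have eqs: "{x, u} \<noteq> e \<Longrightarrow> h x - h u = k {x, u}" "{y, u} \<noteq> e \<Longrightarrow> h y - h u = k {y, u}"
           "{y, v} \<noteq> e \<Longrightarrow> h y - h v = k {y, v}" "{x, v} \<noteq> e \<Longrightarrow> h x - h v = k {x, v}"
        using S4 xy nB h by blast+
      have ds: "{x, u} \<noteq> {y, u}" "{x, u} \<noteq> {y, v}" "{x, u} \<noteq> {x, v}" "{y, u} \<noteq> {y, v}" "{y, u} \<noteq> {x, v}" "{y, v} \<noteq> {x, v}"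
        using d xy nB by simp_all
      have new: "h x - h u = k {x, u} \<and> h y - h u = k {y, u} \<and> h y - h v = k {y, v} \<and> h x - h v = k {x, v}"
        using e4
      proof (elim disjE)
        assume "e = {x, u}"
        then have "h y - h u = k {y, u}" "h y - h v = k {y, v}" "h x - h v = k {x, v}"
          using eqs ds by metis+
        then show ?thesis using k' by (intro conjI; linarith)
      next
        assume "e = {y, u}"
        then have "h x - h u = k {x, u}" "h y - h v = k {y, v}" "h x - h v = k {x, v}"
          using eqs ds by metis+
        then show ?thesis using k' by (intro conjI; linarith)
      next
        assume "e = {y, v}"
        then have "h x - h u = k {x, u}" "h y - h u = k {y, u}" "h x - h v = k {x, v}"
          using eqs ds by metis+
        then show ?thesis using k' by (intro conjI; linarith)
      next
        assume "e = {x, v}"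
        then have "h x - h u = k {x, u}" "h y - h u = k {y, u}" "h y - h v = k {y, v}"
          using eqs ds by metis+
        then show ?thesis using k' by (intro conjI; linarith)
      qed
      have "h b - h w = k {b, w}" if bw: "b \<in> B" "w \<notin> B" "{b, w} \<in> S" for b w
      proof (cases "{b, w} = e")
        case True
        then show ?thesis using e4 new d[OF bw(1) _ bw(2)] xy(1,2) nB by metis
      next
        case False
        then show ?thesis using h bw by blast
      qed
      then show ?thesis by blast
    qed
  qed
  then show ?thesis using drawing_eq_sketch[of G] unfolding internal_faces_def faces_def by simp
qed

section \<open>Propagation along train tracks\<close>

text \<open>
  The pairs of opposite edges are the links of a graph whose vertices are the edges of the original
  graph. Without closed walks that never turn back, this link graph is a forest, so it has a vertex in
  at most one link; that vertex is removed, the rest solved, and its value read off the link.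
\<close>

lemma acyclic_links_solvable:
  fixes opp :: "'f \<Rightarrow> 'e \<Rightarrow> 'e \<Rightarrow> bool" and a :: "'f \<Rightarrow> real"
  assumes X: "finite X"
    and sym: "\<And>f e e'. opp f e e' \<Longrightarrow> opp f e' e" and irr: "\<And>f e. \<not> opp f e e"
    and uniq: "\<And>f e e' e''. opp f e e' \<Longrightarrow> opp f e e'' \<Longrightarrow> e' = e''"
    and noloop: "\<And>es fs n. 0 < n \<Longrightarrow> \<forall>i<n. opp (fs i) (es i) (es (Suc i)) \<Longrightarrow>
      \<forall>i. Suc i < n \<longrightarrow> fs i \<noteq> fs (Suc i) \<Longrightarrow> es 0 = es n \<Longrightarrow> fs 0 = fs (n - 1)"
  shows "\<exists>k. \<forall>e\<in>X. \<forall>e'\<in>X. \<forall>f. opp f e e' \<longrightarrow> k e + k e' = a f"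
  using X
proof (induction X rule: finite_psubset_induct)
  case (psubset X)
  show ?case
  proof (cases "X = {}")
    case False
    have "\<exists>e\<in>X. \<forall>f g. \<forall>e'\<in>X. \<forall>e''\<in>X. opp f e e' \<longrightarrow> opp g e e'' \<longrightarrow> f = g"
    proof (rule ccontr)
      assume "\<not> ?thesis"
      then have two: "\<And>e. e \<in> X \<Longrightarrow> \<exists>f g. \<exists>e'\<in>X. \<exists>e''\<in>X. opp f e e' \<and> opp g e e'' \<and> f \<noteq> g" by meson
      have ext: "\<exists>g. \<exists>e'\<in>X. opp g e e' \<and> g \<noteq> f" if "e \<in> X" for e f using two[OF that] by metis
      obtain e0 where e0: "e0 \<in> X" using False by blast
      have "\<exists>s. \<forall>n. fst (s n) \<in> X \<and> (opp (snd (s (Suc n))) (fst (s n)) (fst (s (Suc n))) \<and> snd (s (Suc n)) \<noteq> snd (s n))"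
      proof (rule dependent_nat_choice)
        show "\<exists>x. fst x \<in> X" using e0 by (intro exI[of _ "(e0, undefined)"]) simp
        show "\<exists>y. fst y \<in> X \<and> (opp (snd y) (fst x) (fst y) \<and> snd y \<noteq> snd x)"
          if x: "fst x \<in> X" for x :: "'e \<times> 'f" and n :: nat
        proof -
          obtain g e' where "e' \<in> X" "opp g (fst x) e'" "g \<noteq> snd x" using ext[OF x] by blast
          then show ?thesis by (intro exI[of _ "(e', g)"]) simp
        qed
      qed
      then obtain s where s: "\<And>n. fst (s n) \<in> X" "\<And>n. opp (snd (s (Suc n))) (fst (s n)) (fst (s (Suc n)))"
        "\<And>n. snd (s (Suc n)) \<noteq> snd (s n)" by metis
      define es where "es n = fst (s n)" for n
      define fs where "fs n = snd (s (Suc n))" for n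
      have walk: "opp (fs n) (es n) (es (Suc n))" "fs (Suc n) \<noteq> fs n" for n
        using s by (auto simp: es_def fs_def)
      have "\<not> inj es"
        using finite_imageD[of es UNIV] finite_subset[of "range es" X] psubset.hyps s(1) by (auto simp: es_def)
      then obtain i j where ij: "i < j" "es i = es j" by (metis injI linorder_neqE_nat)
      \<comment> \<open>a shortest closed stretch of the walk; if it turned back at its closing point, cutting off
        both ends would give a shorter one\<close>
      define P where "P d \<longleftrightarrow> 0 < d \<and> (\<exists>i. es i = es (i + d))" for d
      have "es i = es (i + (j - i))" "0 < j - i" using ij by auto
      then have "P (j - i)" unfolding P_def by blast
      then obtain d where d: "P d" and least: "\<And>d'. d' < d \<Longrightarrow> \<not> P d'"
        using exists_least_iff[of P] by metis
      obtain i where i: "0 < d" "es i = es (i + d)" using d(1) unfolding P_def by blast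
      have "fs (i + 0) = fs (i + (d - 1))"
      proof (rule noloop[of d "\<lambda>n. fs (i + n)" "\<lambda>n. es (i + n)"])
        show "\<forall>n<d. opp (fs (i + n)) (es (i + n)) (es (i + Suc n))"
          "\<forall>n. Suc n < d \<longrightarrow> fs (i + n) \<noteq> fs (i + Suc n)"
          using walk(1) walk(2)[symmetric] by simp_all
      qed (use i in simp_all)
      then have f: "fs i = fs (i + (d - 1))" by simp
      have "d \<noteq> 1" using walk(1)[of i] irr i by auto
      moreover have "d \<noteq> 2" using f walk(2)[of i] by auto
      ultimately have d3: "3 \<le> d" using i(1) by linarith
      have "opp (fs i) (es (i + (d - 1))) (es i)" using walk(1)[of "i + (d - 1)"] f i d3 by simp
      then have "es (Suc i) = es (i + (d - 1))" using uniq[OF walk(1)[of i]] sym by blast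
      also have "i + (d - 1) = Suc i + (d - 2)" using d3 by simp
      finally have "P (d - 2)" using d3 unfolding P_def
        by (intro conjI exI[of _ "Suc i"]) auto
      then show False using least[of "d - 2"] d3 by simp
    qed
    then obtain e where e: "e \<in> X"
      and leaf: "\<And>f g e' e''. e' \<in> X \<Longrightarrow> e'' \<in> X \<Longrightarrow> opp f e e' \<Longrightarrow> opp g e e'' \<Longrightarrow> f = g" by blast
    obtain k where k: "\<And>e1 e2 f. e1 \<in> X - {e} \<Longrightarrow> e2 \<in> X - {e} \<Longrightarrow> opp f e1 e2 \<Longrightarrow> k e1 + k e2 = a f"
      using psubset.IH[of "X - {e}"] e by blast
    have "\<exists>t. \<forall>f. \<forall>e'\<in>X. opp f e e' \<longrightarrow> t + k e' = a f"
    proof (cases "\<exists>f. \<exists>e'\<in>X. opp f e e'")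
      case True
      then obtain f e' where f: "e' \<in> X" "opp f e e'" by blast
      have "a f - k e' + k e'' = a g" if "e'' \<in> X" "opp g e e''" for g e''
      proof -
        have "g = f" using leaf that f by blast
        with uniq[of f e e' e''] f that show ?thesis by simp
      qed
      then show ?thesis by blast
    qed blast
    then obtain t where t: "\<And>f e'. e' \<in> X \<Longrightarrow> opp f e e' \<Longrightarrow> t + k e' = a f" by blast
    have "(k(e := t)) e1 + (k(e := t)) e2 = a f" if "e1 \<in> X" "e2 \<in> X" "opp f e1 e2" for e1 e2 f
      using that k[of e1 e2 f] t[of e2 f] t[of e1 f] sym[OF that(3)] irr[of f e] by (auto simp: add.commute)
    then show ?thesis by blast
  qed simp
qed

lemma train_track_closed_walk:
  assumes noloop: "\<forall>es fs. train_track G es fs \<longrightarrow> \<not> is_loop es fs"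
    and n: "0 < n" and opp: "\<forall>i<n. fs i \<in> internal_faces G \<and> opposite_edges G (fs i) (es i) (es (Suc i))"
    and turn: "\<forall>i. Suc i < n \<longrightarrow> fs i \<noteq> fs (Suc i)" and cl: "es 0 = es n"
  shows "fs 0 = fs (n - 1)"
proof -
  let ?es = "map es [0..<Suc n]" and ?fs = "map fs [0..<n]"
  have "es i \<in> edges G" if "i \<le> n" for i
  proof (cases "i < n")
    case True then show ?thesis using opp by (auto simp: opposite_edges_def face_edges_def)
  next
    case False
    then have "i = Suc (n - 1)" "n - 1 < n" using that n by auto
    then show ?thesis using opp by (auto simp: opposite_edges_def face_edges_def)
  qed
  then have "train_track G ?es ?fs"
    using opp turn unfolding train_track_def by (auto simp del: upt_Suc)
  then have "\<not> is_loop ?es ?fs" using noloop by blast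
  then show ?thesis using n cl by (auto simp: is_loop_def hd_map last_map simp del: upt_Suc)
qed

text \<open>
  The three relations give \<open>w5\<^sup>2 = w1 w2\<close>, \<open>w3\<^sup>2 = w1 (w1 + w2)\<close> and \<open>w4\<^sup>2 = w2 (w1 + w2)\<close>, so up to scaling a
  face has the single degree of freedom \<open>w1 / w2\<close>.
\<close>

lemma weights_from_potential:
  fixes P Q w1 w2 w3 w4 w5 :: real
  assumes p: "w1 > 0" "w2 > 0" "w3 > 0" "w4 > 0" "w5 > 0" and PQ: "P > 0" "Q > 0" "P / Q = w1 / w2"
    and e1: "w1 * w4 = w3 * w5" and e2: "w2 * w3 = w4 * w5" and e3: "w5 * (w1 + w2) = w3 * w4"
  shows "P / w1 * w1 = P \<and> P / w1 * w2 = Q \<and>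
     P / w1 * w3 = sqrt P * sqrt (P + Q) \<and> P / w1 * w4 = sqrt Q * sqrt (P + Q) \<and>
     P / w1 * w5 = sqrt (P * Q)"
proof -
  have c2: "P / w1 * w2 = Q" and c1: "P / w1 * w1 = P" using PQ p by (auto simp: field_simps)
  have "w3 * w4 * (w5)\<^sup>2 = w3 * w4 * (w1 * w2)"
    
    using arg_cong2[OF e1 e2, of "(*)"] by (simp only: power2_eq_square ac_simps)
  then have s5: "(w5)\<^sup>2 = w1 * w2" using p by simp
  have "w4 * (w3)\<^sup>2 = w3 * (w5 * (w1 + w2))" using e3 by (simp add: power2_eq_square algebra_simps)
  also have "\<dots> = (w1 * w4) * (w1 + w2)" using e1 by (simp add: algebra_simps)
  also have "\<dots> = w4 * (w1 * (w1 + w2))" by simp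
  finally have s3: "(w3)\<^sup>2 = w1 * (w1 + w2)" using p by simp
  have "w3 * (w4)\<^sup>2 = w4 * (w5 * (w1 + w2))" using e3 by (simp add: power2_eq_square algebra_simps)
  also have "\<dots> = (w2 * w3) * (w1 + w2)" using e2 by (simp add: algebra_simps)
  also have "\<dots> = w3 * (w2 * (w1 + w2))" by simp
  finally have s4: "(w4)\<^sup>2 = w2 * (w1 + w2)" using p by simp
  define c where "c = P / w1"
  have c: "c > 0" "c * w1 = P" "c * w2 = Q" using PQ p c1 c2 by (auto simp: c_def)
  have "(c * w5)\<^sup>2 = P * Q" "(c * w3)\<^sup>2 = P * (P + Q)" "(c * w4)\<^sup>2 = Q * (P + Q)"
    unfolding power_mult_distrib s3 s4 s5 c(2,3)[symmetric]
    by (simp_all add: power2_eq_square algebra_simps)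
  then have "c * w5 = sqrt (P * Q)" "c * w3 = sqrt (P * (P + Q))" "c * w4 = sqrt (Q * (P + Q))"
    using c p by (metis less_imp_le mult_pos_pos real_sqrt_unique)+
  then show ?thesis using c by (simp add: c_def real_sqrt_mult)
qed

lemma opposite_edges_four_cycle:
  assumes fe: "face_edges G f = {{x, u}, {u, y}, {y, v}, {v, x}}" and d: "distinct [x, u, y, v]"
  shows "opposite_edges G f e e' \<longleftrightarrow>
    e = {x, u} \<and> e' = {y, v} \<or> e = {y, v} \<and> e' = {x, u} \<or>
    e = {u, y} \<and> e' = {v, x} \<or> e = {v, x} \<and> e' = {u, y}" (is "_ \<longleftrightarrow> ?R")
proof
  assume "opposite_edges G f e e'"
  then have "e \<in> {{x, u}, {u, y}, {y, v}, {v, x}}" "e' \<in> {{x, u}, {u, y}, {y, v}, {v, x}}" "e \<inter> e' = {}"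
    unfolding opposite_edges_def fe by blast+
  then show ?R by (elim insertE emptyE) simp_all
next
  assume ?R
  then show "opposite_edges G f e e'" using d unfolding opposite_edges_def fe by (elim disjE) (simp_all, metis+)
qed

lemma four_cycle_opposite_unique:
  assumes fe: "face_edges G f = {{x, u}, {u, y}, {y, v}, {v, x}}" and d: "distinct [x, u, y, v]"
    and "opposite_edges G f e e'" "opposite_edges G f e e''"
  shows "e' = e''"
proof -
  have "{x, u} \<noteq> {y, v}" "{x, u} \<noteq> {u, y}" "{x, u} \<noteq> {v, x}" "{y, v} \<noteq> {u, y}" "{y, v} \<noteq> {v, x}" "{u, y} \<noteq> {v, x}"
    using d by (auto simp: doubleton_eq_iff)
  then show ?thesis using assms(3,4) unfolding opposite_edges_four_cycle[OF fe d] by metis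
qed

text \<open>
  This puts the pieces together: \<open>acyclic_links_solvable\<close> provides the edge form, \<open>closed_form_exact\<close> its
  potential, and \<open>weights_from_potential\<close> the remaining weights of each face.
\<close>

theorem loopless_parametrised:
  fixes G :: "'v drawn_graph" and B :: "'v set" and w :: "complex set \<Rightarrow> nat \<Rightarrow> real"
  assumes Q: "quadrangulation G" and con: "graph_connected G" and bip: "bipartite_colouring G B"
    and pos: "\<forall>f\<in>internal_faces G. \<forall>i\<in>{1..5}. w f i > 0"
    and e1: "\<forall>f\<in>internal_faces G. w f 1 * w f 4 = w f 3 * w f 5"
    and e2: "\<forall>f\<in>internal_faces G. w f 2 * w f 3 = w f 4 * w f 5"
    and e3: "\<forall>f\<in>internal_faces G. w f 5 * (w f 1 + w f 2) = w f 3 * w f 4"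
    and noloop: "\<forall>es fs. train_track G es fs \<longrightarrow> \<not> is_loop es fs"
  shows "vertex_parametrised G B w"
proof -
  have G: "plane_graph G" and deg: "\<And>f. f \<in> internal_faces G \<Longrightarrow> face_degree G f = 4"
    using Q by (auto simp: quadrangulation_def)
  have cyc: "\<exists>x y u v. x \<in> B \<and> y \<in> B \<and> u \<in> verts G - B \<and> v \<in> verts G - B \<and> x \<noteq> y \<and> u \<noteq> v \<and>
           face_edges G f = {{x, u}, {u, y}, {y, v}, {v, x}}" if "f \<in> internal_faces G" for f
    using face_four_cycle[OF G bip that deg[OF that]] .
  define opp where "opp f e e' \<longleftrightarrow> f \<in> internal_faces G \<and> opposite_edges G f e e'" for f e e'
  \<comment> \<open>the logarithm of the ratio that \<open>g x * g y / (g u * g v)\<close> has to attain on \<open>f\<close>\<close>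
  define a where "a f = ln (w f 1 / w f 2)" for f
  have "\<exists>k. \<forall>e\<in>edges G. \<forall>e'\<in>edges G. \<forall>f. opp f e e' \<longrightarrow> k e + k e' = a f"
  proof (rule acyclic_links_solvable[OF plane_graph_finite(2)[OF G]])
    show "opp f e' e" if "opp f e e'" for f e e'
      using that by (auto simp: opp_def opposite_edges_def)
    show "\<not> opp f e e" for f e
    proof
      assume "opp f e e"
      then have "e \<in> edges G" "e = {}" by (auto simp: opp_def opposite_edges_def face_edges_def)
      then show False using plane_graph_edge(2)[OF G] by fastforce
    qed
    show "e' = e''" if o: "opp f e e'" "opp f e e''" for f e e' e''
    proof -
      obtain x y u v where c: "x \<in> B" "y \<in> B" "u \<in> verts G - B" "v \<in> verts G - B" "x \<noteq> y" "u \<noteq> v"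
           "face_edges G f = {{x, u}, {u, y}, {y, v}, {v, x}}"
        using cyc[of f] o by (auto simp: opp_def)
      then have d: "distinct [x, u, y, v]" by auto
      have "opposite_edges G f e e'" "opposite_edges G f e e''" using o by (auto simp: opp_def)
      then show ?thesis by (rule four_cycle_opposite_unique[OF c(7) d])
    qed
    show "fs 0 = fs (n - 1)" if "0 < n" "\<forall>i<n. opp (fs i) (es i) (es (Suc i))"
      "\<forall>i. Suc i < n \<longrightarrow> fs i \<noteq> fs (Suc i)" "es 0 = es n" for es fs n
      using train_track_closed_walk[OF noloop that(1) _ that(3,4)] that(2) by (simp add: opp_def)
  qed
  then obtain k where k: "\<And>f e e'. opp f e e' \<Longrightarrow> e \<in> edges G \<Longrightarrow> e' \<in> edges G \<Longrightarrow> k e + k e' = a f" by metis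
  have k4: "k {x, u} + k {y, v} = a f \<and> k {u, y} + k {v, x} = a f"
    if "f \<in> internal_faces G" "face_edges G f = {{x, u}, {u, y}, {y, v}, {v, x}}" "distinct [x, u, y, v]" for f x y u v
  proof -
    have "opp f {x, u} {y, v}" "opp f {u, y} {v, x}"
      using that opposite_edges_four_cycle[OF that(2,3)] by (auto simp: opp_def)
    moreover have "{x, u} \<in> edges G" "{y, v} \<in> edges G" "{u, y} \<in> edges G" "{v, x} \<in> edges G"
      using face_edges_subset[of G f] that(2) by auto
    ultimately show ?thesis using k by blast
  qed
  have "\<exists>h. \<forall>b\<in>B. \<forall>w. w \<notin> B \<longrightarrow> {b, w} \<in> edges G \<longrightarrow> h b - h w = k {b, w}"
  proof (rule closed_form_exact[OF G bip])
    fix f assume f: "f \<in> internal_faces G"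
    obtain x y u v where c: "x \<in> B" "y \<in> B" "u \<in> verts G - B" "v \<in> verts G - B" "x \<noteq> y" "u \<noteq> v"
           "face_edges G f = {{x, u}, {u, y}, {y, v}, {v, x}}"
      using cyc[OF f] by blast
    then have "distinct [x, u, y, v]" by auto
    then have "k {x, u} + k {y, v} = k {u, y} + k {v, x}" using k4[OF f c(7)] by simp
    with c show "\<exists>x y u v. x \<in> B \<and> y \<in> B \<and> u \<in> verts G - B \<and> v \<in> verts G - B \<and>
      x \<noteq> y \<and> u \<noteq> v \<and> face_edges G f = {{x, u}, {u, y}, {y, v}, {v, x}} \<and>
      k {x, u} + k {y, v} = k {u, y} + k {v, x}" by metis
  qed
  then obtain h where h: "\<And>b w. b \<in> B \<Longrightarrow> w \<notin> B \<Longrightarrow> {b, w} \<in> edges G \<Longrightarrow> h b - h w = k {b, w}" by blast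
  define g where "g v = exp (h v)" for v
  have gpos: "g v > 0" for v by (simp add: g_def)
  have "\<forall>f\<in>internal_faces G. \<exists>c>0. \<exists>x y u v. x \<noteq> y \<and> u \<noteq> v \<and>
           face_verts G f \<inter> B = {x, y} \<and> face_verts G f - B = {u, v} \<and>
           c * w f 1 = g x * g y \<and>
           c * w f 2 = g u * g v \<and>
           c * w f 3 = sqrt (g x * g y) * sqrt (g x * g y + g u * g v) \<and>
           c * w f 4 = sqrt (g u * g v) * sqrt (g x * g y + g u * g v) \<and>
           c * w f 5 = sqrt (g x * g y * g u * g v)"
  proof
    fix f assume f: "f \<in> internal_faces G"
    obtain x y u v where c: "x \<in> B" "y \<in> B" "u \<in> verts G - B" "v \<in> verts G - B" "x \<noteq> y" "u \<noteq> v"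
           and fe: "face_edges G f = {{x, u}, {u, y}, {y, v}, {v, x}}"
      using cyc[OF f] by blast
    have d: "distinct [x, u, y, v]" using c by auto
    have "edges G \<noteq> {}" using face_edges_subset[of G f] fe by blast
    then have "face_verts G f = \<Union>(face_edges G f)"
      using face_verts_eq[OF G con] f by (simp add: internal_faces_def)
    then have fv: "face_verts G f \<inter> B = {x, y}" "face_verts G f - B = {u, v}"
      unfolding fe using c by auto
    have "{x, u} \<in> edges G" "{y, v} \<in> edges G" using face_edges_subset[of G f] fe by auto
    then have "h x - h u = k {x, u}" "h y - h v = k {y, v}" using h c by auto
    then have "(h x + h y) - (h u + h v) = a f" using k4[OF f fe d] by simp
    moreover have p: "w f 1 > 0" "w f 2 > 0" "w f 3 > 0" "w f 4 > 0" "w f 5 > 0" using pos f by auto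
    ultimately have "exp ((h x + h y) - (h u + h v)) = w f 1 / w f 2"
      by (simp add: a_def)
    then have r: "(g x * g y) / (g u * g v) = w f 1 / w f 2"
      by (simp only: g_def exp_diff exp_add)
    have P: "g x * g y > 0" "g u * g v > 0" using gpos by simp_all
    show "\<exists>c>0. \<exists>x y u v. x \<noteq> y \<and> u \<noteq> v \<and>
           face_verts G f \<inter> B = {x, y} \<and> face_verts G f - B = {u, v} \<and>
           c * w f 1 = g x * g y \<and>
           c * w f 2 = g u * g v \<and>
           c * w f 3 = sqrt (g x * g y) * sqrt (g x * g y + g u * g v) \<and>
           c * w f 4 = sqrt (g u * g v) * sqrt (g x * g y + g u * g v) \<and>
           c * w f 5 = sqrt (g x * g y * g u * g v)"
      using weights_from_potential[OF p P r bspec[OF e1 f] bspec[OF e2 f] bspec[OF e3 f]] c(5,6) fv P(1) p(1)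
      by (intro exI[of _ "g x * g y / w f 1"] conjI exI[of _ x] exI[of _ y] exI[of _ u] exI[of _ v])
         (simp_all add: mult.assoc)
  qed
  then obtain c where "\<forall>f\<in>internal_faces G. c f > 0 \<and> (\<exists>x y u v. x \<noteq> y \<and> u \<noteq> v \<and>
           face_verts G f \<inter> B = {x, y} \<and> face_verts G f - B = {u, v} \<and>
           c f * w f 1 = g x * g y \<and>
           c f * w f 2 = g u * g v \<and>
           c f * w f 3 = sqrt (g x * g y) * sqrt (g x * g y + g u * g v) \<and>
           c f * w f 4 = sqrt (g u * g v) * sqrt (g x * g y + g u * g v) \<and>
           c f * w f 5 = sqrt (g x * g y * g u * g v))"
    by (auto dest!: bchoice)
  then show ?thesis unfolding vertex_parametrised_def using gpos by (intro exI[of _ g] exI[of _ c]) blast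
qed

section \<open>Train tracks in lozenge graphs\<close>

text \<open>
  The two-dimensional determinant, i.e. the oriented area spanned by \<open>d\<close> and \<open>z\<close>. Up to the factor
  \<open>norm d\<close> it is the height of \<open>z\<close> above the line through \<open>0\<close> in direction \<open>d\<close>.
\<close>

definition cross :: "complex \<Rightarrow> complex \<Rightarrow> real" where
  "cross d z = Re d * Im z - Im d * Re z"

definition parallelogram :: "complex \<Rightarrow> complex \<Rightarrow> complex \<Rightarrow> complex set" where
  "parallelogram p d c = {p + of_real s * d + of_real t * c | s t. 0 < s \<and> s < 1 \<and> 0 < t \<and> t < (1::real)}"

lemma cross_simps:
  "cross d d = 0" "cross d (z + z') = cross d z + cross d z'" "cross d (of_real t * z) = t * cross d z"
  "cross (z + z') d = cross z d + cross z' d" "cross (of_real t * z) d = t * cross z d"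
  by (simp_all add: cross_def algebra_simps)

text \<open>
  Cramer's rule.
\<close>

lemma cross_coordinates:
  assumes "cross d c \<noteq> 0"
  shows "z = of_real (cross z c / cross d c) * d + of_real (cross d z / cross d c) * c"
proof (rule complex_eqI)
  have "Re z * cross d c = cross z c * Re d + cross d z * Re c"
    by (simp add: cross_def algebra_simps)
  then show "Re z = Re (of_real (cross z c / cross d c) * d + of_real (cross d z / cross d c) * c)"
    using assms by (simp add: field_simps)
  have "Im z * cross d c = cross z c * Im d + cross d z * Im c"
    by (simp add: cross_def algebra_simps)
  then show "Im z = Im (of_real (cross z c / cross d c) * d + of_real (cross d z / cross d c) * c)"
    using assms by (simp add: field_simps)
qed

text \<open>
  The vector \<open>u + v - x - y\<close> is orthogonal to both diagonals, which are nonzero and orthogonal to each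
  other.
\<close>

lemma equilateral_parallelogram:
  fixes x u y v :: complex
  assumes "dist x u = l" "dist u y = l" "dist y v = l" "dist v x = l" "x \<noteq> y" "u \<noteq> v"
  shows "x + y = u + v"
proof -
  define a where "a = u - v"
  define s where "s = y - x"
  define r where "r = u + v - x - y"
  have sq: "(Re (p - q))\<^sup>2 + (Im (p - q))\<^sup>2 = l\<^sup>2" if "dist p q = l" for p q
    using that cmod_power2[of "p - q"] by (simp add: dist_norm)
  note e = sq[OF assms(1)] sq[OF assms(2)] sq[OF assms(3)] sq[OF assms(4)]
  have as: "Re a * Re s + Im a * Im s = 0" and ra: "Re r * Re a + Im r * Im a = 0"
    and rs: "Re r * Re s + Im r * Im s = 0"
    using e unfolding a_def s_def r_def power2_eq_square plus_complex.sel minus_complex.sel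
    by (simp_all only: algebra_simps)
  have "(cross a s)\<^sup>2 = ((Re a)\<^sup>2 + (Im a)\<^sup>2) * ((Re s)\<^sup>2 + (Im s)\<^sup>2) - (Re a * Re s + Im a * Im s)\<^sup>2"
    by (simp add: cross_def power2_eq_square algebra_simps)
  also have "\<dots> > 0"
  proof -
    have "a \<noteq> 0" "s \<noteq> 0" using assms(5,6) by (auto simp: a_def s_def)
    then have "(Re a)\<^sup>2 + (Im a)\<^sup>2 > 0" "(Re s)\<^sup>2 + (Im s)\<^sup>2 > 0"
      by (auto simp: sum_power2_gt_zero_iff complex_eq_iff)
    then show ?thesis unfolding as by simp
  qed
  finally have ne: "cross a s \<noteq> 0" by auto
  have "Re r * cross a s = (Re r * Re a + Im r * Im a) * Im s - (Re r * Re s + Im r * Im s) * Im a"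
    "Im r * cross a s = (Re r * Re s + Im r * Im s) * Re a - (Re r * Re a + Im r * Im a) * Re s"
    by (simp_all add: cross_def algebra_simps)
  then have "Re r * cross a s = 0" "Im r * cross a s = 0" unfolding ra rs by simp_all
  then have "r = 0" using ne by (simp add: complex_eq_iff)
  then show ?thesis by (simp add: r_def algebra_simps)
qed

text \<open>
  In the affine coordinates along \<open>d\<close> and \<open>c\<close> the closed parallelogram is the unit square. It is convex
  and bounded, so its complement is connected and unbounded, and only the open parallelogram
  remains as a bounded component.
\<close>

lemma bounded_component_parallelogram:
  assumes D: "cross d c \<noteq> 0"
    and f: "f \<in> components (- (closed_segment p (p + d) \<union> closed_segment (p + d) (p + d + c) \<union>
              closed_segment (p + d + c) (p + c) \<union> closed_segment (p + c) p))" "bounded f"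
  shows "f = parallelogram p d c"
proof -
  define S where "S z = cross (z - p) c / cross d c" for z
  define T where "T z = cross d (z - p) / cross d c" for z
  have co: "z = p + of_real (S z) * d + of_real (T z) * c" for z
    using cross_coordinates[OF D, of "z - p"] by (simp add: S_def T_def algebra_simps)
  have ST: "S (p + of_real s * d + of_real t * c) = s" "T (p + of_real s * d + of_real t * c) = t" for s t
    using D by (simp_all add: S_def T_def cross_simps)
  have contS: "continuous_on A S" and contT: "continuous_on A T" for A
    unfolding S_def T_def cross_def using D by (intro continuous_intros; simp add: cross_def)+
  let ?K = "closed_segment p (p + d) \<union> closed_segment (p + d) (p + d + c) \<union>
              closed_segment (p + d + c) (p + c) \<union> closed_segment (p + c) p"
  let ?Q = "parallelogram p d c"
  have Q: "?Q = {z. 0 < S z \<and> S z < 1 \<and> 0 < T z \<and> T z < 1}"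
    using co ST by (fastforce simp: parallelogram_def)
  define P where "P = {z. 0 \<le> S z \<and> S z \<le> 1 \<and> 0 \<le> T z \<and> T z \<le> 1}"
  have seg: "closed_segment z z' = {z + of_real t * (z' - z) | t. 0 \<le> t \<and> t \<le> 1}" for z z' :: complex
    by (auto simp: closed_segment_def scaleR_conv_of_real algebra_simps)
  have K: "?K = P - ?Q"
  proof (rule equalityI; rule subsetI)
    fix z assume "z \<in> ?K"
    then have "\<exists>s t. z = p + of_real s * d + of_real t * c \<and> 0 \<le> s \<and> s \<le> 1 \<and> 0 \<le> t \<and> t \<le> 1 \<and>
        (s = 0 \<or> s = 1 \<or> t = 0 \<or> t = 1)"
    proof (elim UnE)
      assume "z \<in> closed_segment p (p + d)"
      then obtain t where "0 \<le> t" "t \<le> 1" "z = p + of_real t * d" by (auto simp: seg)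
      then show ?thesis by (intro exI[of _ t] exI[of _ 0]) simp
    next
      assume "z \<in> closed_segment (p + d) (p + d + c)"
      then obtain t where "0 \<le> t" "t \<le> 1" "z = p + d + of_real t * c" by (auto simp: seg)
      then show ?thesis by (intro exI[of _ 1] exI[of _ t]) simp
    next
      assume "z \<in> closed_segment (p + d + c) (p + c)"
      then obtain t where "0 \<le> t" "t \<le> 1" "z = p + d + c - of_real t * d" by (auto simp: seg)
      then show ?thesis by (intro exI[of _ "1 - t"] exI[of _ 1]) (simp add: algebra_simps)
    next
      assume "z \<in> closed_segment (p + c) p"
      then obtain t where "0 \<le> t" "t \<le> 1" "z = p + c - of_real t * c" by (auto simp: seg)
      then show ?thesis by (intro exI[of _ 0] exI[of _ "1 - t"]) (simp add: algebra_simps)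
    qed
    then obtain s t where z: "z = p + of_real s * d + of_real t * c" and b: "0 \<le> s" "s \<le> 1" "0 \<le> t" "t \<le> 1"
      "s = 0 \<or> s = 1 \<or> t = 0 \<or> t = 1" by blast
    have "S z = s" "T z = t" unfolding z by (rule ST)+
    then show "z \<in> P - ?Q" unfolding Q P_def using b by auto
  next
    fix z assume z: "z \<in> P - ?Q"
    have r: "0 \<le> S z" "S z \<le> 1" "0 \<le> T z" "T z \<le> 1" using z by (auto simp: P_def)
    have "S z = 0 \<or> S z = 1 \<or> T z = 0 \<or> T z = 1" using z unfolding Q P_def by auto
    then show "z \<in> ?K"
    proof (elim disjE)
      assume "S z = 0"
      then have "z = (p + c) + of_real (1 - T z) * (p - (p + c))" using co[of z] by (simp add: algebra_simps)
      then have "z \<in> closed_segment (p + c) p" unfolding seg using r by (intro CollectI exI[of _ "1 - T z"]) simp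
      then show ?thesis by blast
    next
      assume "S z = 1"
      then have "z = (p + d) + of_real (T z) * (p + d + c - (p + d))" using co[of z] by (simp add: algebra_simps)
      then have "z \<in> closed_segment (p + d) (p + d + c)" unfolding seg using r by (intro CollectI exI[of _ "T z"]) simp
      then show ?thesis by blast
    next
      assume "T z = 0"
      then have "z = p + of_real (S z) * (p + d - p)" using co[of z] by (simp add: algebra_simps)
      then have "z \<in> closed_segment p (p + d)" unfolding seg using r by (intro CollectI exI[of _ "S z"]) simp
      then show ?thesis by blast
    next
      assume "T z = 1"
      then have "z = (p + d + c) + of_real (1 - S z) * (p + c - (p + d + c))" using co[of z] by (simp add: algebra_simps)
      then have "z \<in> closed_segment (p + d + c) (p + c)" unfolding seg using r by (intro CollectI exI[of _ "1 - S z"]) simp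
      then show ?thesis by blast
    qed
  qed
  have aff: "S ((1 - m) *\<^sub>R z + m *\<^sub>R z') = (1 - m) * S z + m * S z'" 
    "T ((1 - m) *\<^sub>R z + m *\<^sub>R z') = (1 - m) * T z + m * T z'" for m z z'
  proof -
    have "cross ((1 - m) *\<^sub>R z + m *\<^sub>R z' - p) c = (1 - m) * cross (z - p) c + m * cross (z' - p) c"
      "cross d ((1 - m) *\<^sub>R z + m *\<^sub>R z' - p) = (1 - m) * cross d (z - p) + m * cross d (z' - p)"
      by (simp_all add: cross_def algebra_simps)
    then show "S ((1 - m) *\<^sub>R z + m *\<^sub>R z') = (1 - m) * S z + m * S z'" 
      "T ((1 - m) *\<^sub>R z + m *\<^sub>R z') = (1 - m) * T z + m * T z'"
      by (simp_all add: S_def T_def add_divide_distrib)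
  qed
  have conv: "convex {z. S z \<in> I \<and> T z \<in> I}" if "convex I" for I
    unfolding convex_alt
  proof (intro ballI allI impI)
    fix z z' :: complex and m :: real
    assume "z \<in> {z. S z \<in> I \<and> T z \<in> I}" "z' \<in> {z. S z \<in> I \<and> T z \<in> I}" and "0 \<le> m \<and> m \<le> 1"
    then show "(1 - m) *\<^sub>R z + m *\<^sub>R z' \<in> {z. S z \<in> I \<and> T z \<in> I}"
      using convexD_alt[OF that, of "S z" "S z'" m] convexD_alt[OF that, of "T z" "T z'" m] by (simp add: aff)
  qed
  have "?Q = {z. S z \<in> {0<..<1} \<and> T z \<in> {0<..<1}}" unfolding Q by auto
  then have "convex ?Q" using conv[of "{0<..<1}"] by simp
  then have conQ: "connected ?Q" by (rule convex_connected)
  have openQ: "open ?Q" unfolding Q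
    by (intro open_Collect_conj open_Collect_less contS contT continuous_on_const)
  have "P = {z. S z \<in> {0..1} \<and> T z \<in> {0..1}}" unfolding P_def by auto
  then have convP: "convex P" using conv[of "{0..1}"] by simp
  have closedP: "closed P" unfolding P_def
    by (intro closed_Collect_conj closed_Collect_le contS contT continuous_on_const)
  have "P \<subseteq> cball p (norm d + norm c)"
  proof
    fix z assume "z \<in> P"
    then have r: "\<bar>S z\<bar> \<le> 1" "\<bar>T z\<bar> \<le> 1" by (auto simp: P_def)
    have "norm (z - p) = norm (of_real (S z) * d + of_real (T z) * c)" 
      using arg_cong[OF co[of z], of "\<lambda>z'. norm (z' - p)"] by (simp add: add.assoc)
    also have "\<dots> \<le> \<bar>S z\<bar> * norm d + \<bar>T z\<bar> * norm c"
      by (rule order_trans[OF norm_triangle_ineq]) (simp add: norm_mult)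
    also have "\<dots> \<le> 1 * norm d + 1 * norm c" using r by (intro add_mono mult_right_mono) auto
    finally show "z \<in> cball p (norm d + norm c)" by (simp add: dist_norm norm_minus_commute)
  qed
  then have bP: "bounded P" using bounded_cball bounded_subset by blast
  have conP: "connected (- P)" using connected_complement_bounded_convex[OF bP convP] by simp
  have QP: "?Q \<subseteq> P" unfolding Q P_def by auto
  then have cover: "- ?K = ?Q \<union> - P" unfolding K by blast
  have fs: "f \<subseteq> ?Q \<union> - P" "connected f" "f \<noteq> {}"
    using in_components_subset[OF f(1)] in_components_connected[OF f(1)] in_components_nonempty[OF f(1)]
    unfolding cover by auto
  have ub: "\<not> bounded (- P)" using cobounded_imp_unbounded[of "- P"] bP by simp
  have "f \<inter> - P = {}"
  proof (rule ccontr)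
    assume "f \<inter> - P \<noteq> {}"
    then have "- P \<subseteq> f" using components_maximal[OF f(1) conP] cover by blast
    then show False using ub f(2) bounded_subset by blast
  qed
  then have "f \<subseteq> ?Q" using fs(1) by blast
  moreover have "?Q \<subseteq> f" using components_maximal[OF f(1) conQ] cover fs(3) \<open>f \<subseteq> ?Q\<close> by blast
  ultimately show ?thesis by blast
qed

text \<open>
  Were \<open>c\<close> and \<open>c'\<close> on opposite sides of the direction \<open>d\<close>, the two parallelograms would lie on the same
  side of their common edge and overlap near its midpoint.
\<close>

lemma adjacent_parallelograms:
  assumes D: "cross d c \<noteq> 0" "cross d c' \<noteq> 0"
    and disj: "parallelogram p d c \<inter> parallelogram (p + c) d c' = {}"
  shows "cross d c * cross d c' > 0"
proof (rule ccontr)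
  assume neg: "\<not> cross d c * cross d c' > 0"
  \<comment> \<open>the coordinates \<open>c = \<alpha> d - \<beta> c'\<close>, with \<open>\<beta> > 0\<close> in the case to be excluded\<close>
  define \<beta> where "\<beta> = - (cross d c / cross d c')"
  define \<alpha> where "\<alpha> = cross c c' / cross d c'"
  have "cross d c * cross d c' < 0" using neg D by (meson linorder_neqE_linordered_idom no_zero_divisors)
  then have b: "\<beta> > 0" unfolding \<beta>_def by (auto simp: divide_less_0_iff mult_less_0_iff)
  have "c = of_real \<alpha> * d - of_real \<beta> * c'"
    using cross_coordinates[OF D(2), of c] by (simp add: \<alpha>_def \<beta>_def)
  then have c': "of_real \<beta> * c' = of_real \<alpha> * d - c" by (simp add: algebra_simps)
  \<comment> \<open>a common point: the midpoint of the shared edge, moved by \<open>m * \<beta>\<close> along \<open>c'\<close>; \<open>m\<close> is small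
    enough for it to stay inside both parallelograms\<close>
  define m where "m = 1 / (\<beta> + 1 + 2 * \<bar>\<alpha>\<bar>)"
  have m: "0 < m" "m < 1" "m * \<beta> < 1" "\<bar>m * \<alpha>\<bar> < 1/2"
    using b by (auto simp: m_def abs_mult field_simps)
  have "p + c + of_real (1/2) * d + of_real (m * \<beta>) * c' = p + c + of_real (1/2) * d + of_real m * (of_real \<beta> * c')"
    by (simp add: mult.assoc)
  also have "\<dots> = p + of_real (1/2 + m * \<alpha>) * d + of_real (1 - m) * c"
    unfolding c' by (simp add: algebra_simps)
  finally have eq: "p + c + of_real (1/2) * d + of_real (m * \<beta>) * c' =
    p + of_real (1/2 + m * \<alpha>) * d + of_real (1 - m) * c" .
  have "p + c + of_real (1/2) * d + of_real (m * \<beta>) * c' \<in> parallelogram (p + c) d c'"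
    unfolding parallelogram_def using m b by (intro CollectI exI[of _ "1/2"] exI[of _ "m * \<beta>"]) auto
  moreover have "p + c + of_real (1/2) * d + of_real (m * \<beta>) * c' \<in> parallelogram p d c"
    unfolding eq parallelogram_def using m b
    by (intro CollectI exI[of _ "1/2 + m * \<alpha>"] exI[of _ "1 - m"]) auto
  ultimately show False using disj by blast
qed

text \<open>
  Unlike \<open>rhombic_face\<close>, this form keeps only what the monotonicity argument needs, and its
  symmetries under rotation and reflection of the corners are immediate.
\<close>

definition parallelogram_face :: "'v drawn_graph \<Rightarrow> complex set \<Rightarrow> 'v \<Rightarrow> 'v \<Rightarrow> 'v \<Rightarrow> 'v \<Rightarrow> bool" where
  "parallelogram_face G f x u y v \<longleftrightarrow> distinct [x, u, y, v] \<and>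
     face_edges G f = {{x, u}, {u, y}, {y, v}, {v, x}} \<and>
     frontier f = closed_segment (vpos G x) (vpos G u) \<union> closed_segment (vpos G u) (vpos G y) \<union>
       closed_segment (vpos G y) (vpos G v) \<union> closed_segment (vpos G v) (vpos G x) \<and>
     vpos G x + vpos G y = vpos G u + vpos G v \<and>
     cross (vpos G u - vpos G x) (vpos G v - vpos G x) \<noteq> 0"

lemma parallelogram_face_rotate: "parallelogram_face G f x u y v \<Longrightarrow> parallelogram_face G f u y v x"
proof -
  assume a: "parallelogram_face G f x u y v"
  then have s: "vpos G x + vpos G y = vpos G u + vpos G v" by (simp add: parallelogram_face_def)
  then have y: "vpos G y = vpos G u + vpos G v - vpos G x" by (simp add: algebra_simps)
  have "cross (vpos G y - vpos G u) (vpos G x - vpos G u) = cross (vpos G u - vpos G x) (vpos G v - vpos G x)"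
    unfolding y by (simp add: cross_def algebra_simps)
  then show "parallelogram_face G f u y v x"
    using a unfolding parallelogram_face_def by (auto simp: s insert_commute Un_ac add.commute)
qed

lemma parallelogram_face_reflect: "parallelogram_face G f x u y v \<Longrightarrow> parallelogram_face G f u x v y"
proof -
  assume a: "parallelogram_face G f x u y v"
  then have s: "vpos G x + vpos G y = vpos G u + vpos G v" by (simp add: parallelogram_face_def)
  then have y: "vpos G y = vpos G u + vpos G v - vpos G x" by (simp add: algebra_simps)
  have "cross (vpos G x - vpos G u) (vpos G y - vpos G u) = - cross (vpos G u - vpos G x) (vpos G v - vpos G x)"
    unfolding y by (simp add: cross_def algebra_simps)
  then show "parallelogram_face G f u x v y"
    using a unfolding parallelogram_face_def
    by (auto simp: s insert_commute Un_ac add.commute closed_segment_commute)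
qed

lemma rhombic_face_parallelogram:
  assumes G: "plane_graph G" and f: "f \<in> internal_faces G" and r: "rhombic_face G l f"
  obtains x u y v where "parallelogram_face G f x u y v"
proof -
  obtain x u y v where dis: "distinct [x, u, y, v]" and fv: "face_verts G f = {x, u, y, v}"
    and fe: "face_edges G f = {{x, u}, {u, y}, {y, v}, {v, x}}"
    and im: "path_image (curve G {x, u}) = closed_segment (vpos G x) (vpos G u)"
        "path_image (curve G {u, y}) = closed_segment (vpos G u) (vpos G y)"
        "path_image (curve G {y, v}) = closed_segment (vpos G y) (vpos G v)"
        "path_image (curve G {v, x}) = closed_segment (vpos G v) (vpos G x)"
    and ds: "dist (vpos G x) (vpos G u) = l" "dist (vpos G u) (vpos G y) = l"
        "dist (vpos G y) (vpos G v) = l" "dist (vpos G v) (vpos G x) = l"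
    and nc: "\<not> collinear (vpos G ` {x, u, y, v})"
    using r unfolding rhombic_face_def by blast
  have "sketch G (face_verts G f) (face_edges G f) = closed_segment (vpos G x) (vpos G u) \<union>
    closed_segment (vpos G u) (vpos G y) \<union> closed_segment (vpos G y) (vpos G v) \<union> closed_segment (vpos G v) (vpos G x)"
    unfolding sketch_def fv fe by (simp add: im, blast)
  moreover have "frontier f \<subseteq> sketch G (face_verts G f) (face_edges G f)"
    using frontier_face[OF G] f by (simp add: internal_faces_def)
  moreover have "sketch G (face_verts G f) (face_edges G f) \<subseteq> frontier f"
    by (auto simp: sketch_def face_verts_def face_edges_def)
  ultimately have fr: "frontier f = closed_segment (vpos G x) (vpos G u) \<union>
    closed_segment (vpos G u) (vpos G y) \<union> closed_segment (vpos G y) (vpos G v) \<union> closed_segment (vpos G v) (vpos G x)"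
    by blast
  have "x \<in> verts G" "u \<in> verts G" "y \<in> verts G" "v \<in> verts G"
    using face_verts_subset[of G f] fv by auto
  then have "vpos G x \<noteq> vpos G y" "vpos G u \<noteq> vpos G v"
    using dis plane_graph_inj[OF G] by (auto simp: inj_on_eq_iff)
  then have s: "vpos G x + vpos G y = vpos G u + vpos G v"
    using equilateral_parallelogram[OF ds] by blast
  define d where "d = vpos G u - vpos G x"
  define c where "c = vpos G v - vpos G x"
  have "cross (vpos G u - vpos G x) (vpos G v - vpos G x) \<noteq> 0"
  proof
    assume "cross (vpos G u - vpos G x) (vpos G v - vpos G x) = 0"
    then have 0: "Re d * Im c = Im d * Re c" by (simp add: cross_def d_def c_def)
    have "x \<in> verts G" "u \<in> verts G" "x \<noteq> u" using dis face_verts_subset[of G f] fv by auto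
    then have "d \<noteq> 0" using plane_graph_inj[OF G] by (simp add: d_def inj_on_eq_iff)
    then have n: "(Re d)\<^sup>2 + (Im d)\<^sup>2 > 0" by (simp add: sum_power2_gt_zero_iff complex_eq_iff)
    define t where "t = (Re d * Re c + Im d * Im c) / ((Re d)\<^sup>2 + (Im d)\<^sup>2)"
    have "c = t *\<^sub>R d"
    proof (rule complex_eqI)
      have "Re c * ((Re d)\<^sup>2 + (Im d)\<^sup>2) = (Re d * Re c + Im d * Im c) * Re d"
        using 0 by (simp add: power2_eq_square algebra_simps)
      then show "Re c = Re (t *\<^sub>R d)" using n by (auto simp: t_def eq_divide_eq)
      have "Im c * ((Re d)\<^sup>2 + (Im d)\<^sup>2) = (Re d * Re c + Im d * Im c) * Im d"
        using 0 by (simp add: power2_eq_square algebra_simps)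
      then show "Im c = Im (t *\<^sub>R d)" using n by (auto simp: t_def eq_divide_eq)
    qed
    then have v: "vpos G v = vpos G x + t *\<^sub>R d" by (simp add: c_def algebra_simps)
    have u: "vpos G u = vpos G x + 1 *\<^sub>R d" and x: "vpos G x = vpos G x + 0 *\<^sub>R d" by (simp_all add: d_def)
    have "vpos G y = vpos G u + vpos G v - vpos G x" using s by (simp add: algebra_simps)
    then have y: "vpos G y = vpos G x + (1 + t) *\<^sub>R d" unfolding v by (simp add: d_def algebra_simps)
    have "collinear (vpos G ` {x, u, y, v})"
      unfolding collinear_alt using v u x y by (intro exI[of _ "vpos G x"] exI[of _ d]) blast
    with nc show False by blast
  qed
  then show ?thesis using that dis fe fr s unfolding parallelogram_face_def by blast
qed


lemma parallelogram_face_at_edge: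
  assumes "parallelogram_face G f x u y v" "{a, b} \<in> face_edges G f"
  obtains r s where "parallelogram_face G f a b r s"
proof -
  note 1 = assms(1) parallelogram_face_rotate[OF assms(1)]
    parallelogram_face_rotate[OF parallelogram_face_rotate[OF assms(1)]]
    parallelogram_face_rotate[OF parallelogram_face_rotate[OF parallelogram_face_rotate[OF assms(1)]]]
  note 2 = 1[THEN parallelogram_face_reflect]
  have "{a, b} \<in> {{x, u}, {u, y}, {y, v}, {v, x}}" using assms by (simp add: parallelogram_face_def)
  then have "(a, b) \<in> {(x, u), (u, x), (u, y), (y, u), (y, v), (v, y), (v, x), (x, v)}"
    by (auto simp: doubleton_eq_iff)
  then show ?thesis using that 1 2 by auto
qed

text \<open>
  Crossing a rhombus translates the edge, so all edges crossed by a train track are parallel.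
\<close>

lemma opposite_edge_translate:
  assumes G: "plane_graph G" and f: "f \<in> internal_faces G" and r: "rhombic_face G l f"
    and opp: "opposite_edges G f {a, b} e'"
  obtains a' b' c where "e' = {a', b'}" "vpos G a' = vpos G a + c" "vpos G b' = vpos G b + c"
    "cross (vpos G b - vpos G a) c \<noteq> 0" "f = parallelogram (vpos G a) (vpos G b - vpos G a) c"
proof -
  obtain x u y v where "parallelogram_face G f x u y v" using rhombic_face_parallelogram[OF G f r] .
  moreover have "{a, b} \<in> face_edges G f" using opp by (simp add: opposite_edges_def)
  ultimately obtain p q where P: "parallelogram_face G f a b p q" by (rule parallelogram_face_at_edge)
  then have dis: "distinct [a, b, p, q]" and fe: "face_edges G f = {{a, b}, {b, p}, {p, q}, {q, a}}"
    and fr: "frontier f = closed_segment (vpos G a) (vpos G b) \<union> closed_segment (vpos G b) (vpos G p) \<union>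
       closed_segment (vpos G p) (vpos G q) \<union> closed_segment (vpos G q) (vpos G a)"
    and s: "vpos G a + vpos G p = vpos G b + vpos G q"
    and cr: "cross (vpos G b - vpos G a) (vpos G q - vpos G a) \<noteq> 0"
    unfolding parallelogram_face_def by blast+
  define d where "d = vpos G b - vpos G a"
  define c where "c = vpos G q - vpos G a"
  have e': "e' = {q, p}" using opp dis unfolding opposite_edges_four_cycle[OF fe dis]
    by (auto simp: doubleton_eq_iff)
  have b: "vpos G b = vpos G a + d" and q: "vpos G q = vpos G a + c" by (simp_all add: d_def c_def)
  have p: "vpos G p = vpos G a + d + c"
  proof -
    have "vpos G p = vpos G b + vpos G q - vpos G a" using s by (metis add_diff_cancel_left')
    then show ?thesis unfolding b q by simp
  qed
  have fc: "f \<in> components (- drawing G)" "bounded f" using f by (auto simp: internal_faces_def faces_def)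
  have "closed (drawing G)"
    using compact_sketch[OF G order_refl order_refl] by (simp add: drawing_eq_sketch compact_imp_closed)
  then have "frontier f \<subseteq> drawing G" using frontier_of_components_closed_complement fc(1) by blast
  then have "f \<in> components (- frontier f)" by (intro component_subset_Compl[OF fc(1)]) auto
  then have "f = parallelogram (vpos G a) d c"
    using fc(2) cr unfolding fr unfolding d_def[symmetric] c_def[symmetric] b q p
    by (intro bounded_component_parallelogram) auto
  moreover have "vpos G p = vpos G b + c" using p b by simp
  ultimately show ?thesis using that[of q p c] e' q cr unfolding d_def[symmetric] c_def[symmetric] by blast
qed

text \<open>
  Two consecutive rhombi lie on opposite sides of the edge they share, so the height of the crossed
  edges in the direction orthogonal to them is strictly monotone along the track.
\<close>

lemma lozenge_no_loop:
  assumes L: "lozenge_graph G" and t: "train_track G es fs"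
  shows "\<not> is_loop es fs"
proof
  assume loop: "is_loop es fs"
  have G: "plane_graph G" using L by (simp add: lozenge_graph_def quadrangulation_def)
  obtain l where l: "\<And>f. f \<in> internal_faces G \<Longrightarrow> rhombic_face G l f"
    using L by (auto simp: lozenge_graph_def)
  define n where "n = length fs"
  have n: "0 < n" "length es = Suc n" using t loop by (auto simp: n_def train_track_def is_loop_def)
  have fI: "fs ! i \<in> internal_faces G" if "i < n" for i
    using t that by (auto simp: train_track_def n_def)
  have opp: "opposite_edges G (fs ! i) (es ! i) (es ! Suc i)" if "i < n" for i
    using t that by (auto simp: train_track_def n_def)
  have turn: "fs ! i \<noteq> fs ! Suc i" if "Suc i < n" for i
    using t that by (auto simp: train_track_def n_def)
  have "es \<noteq> []" using n(2) by auto
  then have closed: "es ! 0 = es ! n" using loop n(2) by (simp add: is_loop_def hd_conv_nth last_conv_nth)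
  have "es ! 0 \<in> edges G" using opp[OF n(1)] by (simp add: opposite_edges_def face_edges_def)
  then obtain a b where ab: "es ! 0 = {a, b}" using plane_graph_edge(2)[OF G] by (meson card_2_iff)
  define d where "d = vpos G b - vpos G a"
  have step: "\<exists>a' b' c. es ! Suc i = {a', b'} \<and> vpos G a' = vpos G p + c \<and> vpos G b' = vpos G q + c \<and>
      cross d c \<noteq> 0 \<and> fs ! i = parallelogram (vpos G p) d c"
    if "i < n" "es ! i = {p, q}" "vpos G q - vpos G p = d" for i p q
    using opposite_edge_translate[OF G fI[OF that(1)] l[OF fI[OF that(1)]], of p q] opp[OF that(1)] that(2,3)
    by metis
  obtain a1 b1 c1 where 1: "es ! Suc 0 = {a1, b1}" "vpos G a1 = vpos G a + c1" "vpos G b1 = vpos G b + c1"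
      "cross d c1 \<noteq> 0" "fs ! 0 = parallelogram (vpos G a) d c1"
    using step[OF n(1) ab] d_def by blast
  \<comment> \<open>the sign of the first translation is kept along the track, so the height above the first edge
    never returns to zero\<close>
  have "\<exists>p q a' b' c. es ! i = {p, q} \<and> vpos G q - vpos G p = d \<and> es ! Suc i = {a', b'} \<and>
      vpos G a' = vpos G p + c \<and> vpos G b' = vpos G q + c \<and> fs ! i = parallelogram (vpos G p) d c \<and>
      cross d c1 * cross d c > 0 \<and> cross d c1 * cross d (vpos G a' - vpos G a) > 0" if "i < n" for i
    using that
  proof (induction i)
    case 0
    have "cross d c1 * cross d c1 > 0" using 1(4) by (simp add: zero_less_mult_iff linorder_neq_iff disj_commute)
    then show ?case using 1 ab d_def
      by (intro exI[of _ a] exI[of _ b] exI[of _ a1] exI[of _ b1] exI[of _ c1]) simp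
  next
    case (Suc i)
    then obtain p q a' b' c where h: "es ! i = {p, q}" "vpos G q - vpos G p = d" "es ! Suc i = {a', b'}"
      "vpos G a' = vpos G p + c" "vpos G b' = vpos G q + c" "fs ! i = parallelogram (vpos G p) d c"
      "cross d c1 * cross d c > 0" "cross d c1 * cross d (vpos G a' - vpos G a) > 0" by auto
    have d': "vpos G b' - vpos G a' = d" using h(2,4,5) by simp
    obtain a2 b2 c' where h': "es ! Suc (Suc i) = {a2, b2}" "vpos G a2 = vpos G a' + c'" "vpos G b2 = vpos G b' + c'"
      "cross d c' \<noteq> 0" "fs ! Suc i = parallelogram (vpos G a') d c'"
      using step[OF Suc.prems h(3) d'] by blast
    have "fs ! i \<inter> fs ! Suc i = {}"
      using components_nonoverlap[of "fs ! i" "- drawing G" "fs ! Suc i"] fI[of i] fI[of "Suc i"] turn Suc.prems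
      by (simp add: internal_faces_def faces_def)
    then have "cross d c * cross d c' > 0"
      using h(7) h'(4) unfolding h(6) h'(5) h(4) by (intro adjacent_parallelograms) auto
    then have pos: "cross d c1 * cross d c' > 0" using h(7) by (simp add: zero_less_mult_iff) linarith
    have "cross d c1 * cross d (vpos G a2 - vpos G a) =
        cross d c1 * cross d (vpos G a' - vpos G a) + cross d c1 * cross d c'"
      unfolding h'(2) by (simp add: cross_def algebra_simps)
    also have "\<dots> > 0" using pos h(8) by simp
    finally show ?case using h(3) d' h' pos by blast
  qed
  from this[of "n - 1"] n(1) obtain a' b' where "es ! n = {a', b'}" "cross d c1 * cross d (vpos G a' - vpos G a) > 0"
    by auto
  moreover from this have "a' = a \<or> a' = b" using closed ab by auto
  moreover have "cross d (vpos G b - vpos G a) = 0" unfolding d_def[symmetric] by (simp add: cross_def)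
  ultimately show False by (auto simp: cross_def)
qed

section \<open>The parametrisation\<close>

theorem mainTheorem6:
  fixes G :: "'v drawn_graph" and B :: "'v set" and w :: "complex set \<Rightarrow> nat \<Rightarrow> real"
  assumes "quadrangulation G" and "graph_connected G" and "bipartite_colouring G B"
    and "\<forall>f\<in>internal_faces G. \<forall>i\<in>{1..5}. w f i > 0"
    and "\<forall>f\<in>internal_faces G. w f 1 * w f 4 = w f 3 * w f 5"
    and "\<forall>f\<in>internal_faces G. w f 2 * w f 3 = w f 4 * w f 5"
    and "\<forall>f\<in>internal_faces G. w f 5 * (w f 1 + w f 2) = w f 3 * w f 4"
  shows "((\<forall>es fs. train_track G es fs \<longrightarrow> \<not> is_loop es fs) \<longrightarrow> vertex_parametrised G B w) \<and>
         (lozenge_graph G \<longrightarrow> vertex_parametrised G B w)"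
  using loopless_parametrised[OF assms] lozenge_no_loop by blast

end
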